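(* Let $X$ be an infinite dimensional separable metric space and let $\alpha={\sf tp}_{{\sf S}_1(\mathcal{O}_{\sf kfd},\mathcal{O})}(X)$. Then $\dim_G(X)\le \alpha$ if $\alpha$ is a limit ordinal, and $\dim_G(X)\le \alpha+\omega$ otherwise.
   Context: A space is finite dimensional if its Lebesgue covering dimension is finite, and infinite dimensional otherwise. For a separable metric space $X$, $\mathcal{O}$ denotes the collection of all open covers of $X$, and $\mathcal{O}_{\sf kfd}$ denotes the collection of open covers $\mathcal{U}$ of $X$ such that for each compact finite dimensional subset $T\subseteq X$ there is $U\in\mathcal{U}$ with $T\subseteq U$ (the case $X\in\mathcal{U}$ is allowed). For an ordinal $\alpha$, the game ${\sf G}_1^{\alpha}(\mathcal{O}_{\sf kfd},\mathcal{O})$ on $X$ has one inning per $\gamma<\alpha$: in inning $\gamma$ player ONE chooses $A_\gamma\in\mathcal{O}_{\sf kfd}$ and TWO responds with $B_\gamma\in A_\gamma$. TWO wins the play if $\{B_\gamma:\gamma<\alpha\}$ is an open cover of $X$; otherwise ONE wins. ${\sf tp}_{{\sf S}_1(\mathcal{O}_{\sf kfd},\mathcal{O})}(X)$ is the least ordinal $\alpha$ such that TWO has a winning strategy in this game on $X$. For an ordinal $\beta$, the game ${\sf G}_c^{\beta}(\mathcal{O},\mathcal{O})$ on $X$ has one inning per $\gamma<\beta$: in inning $\gamma$ ONE chooses an open cover $A_\gamma$ of $X$ and TWO responds with a pairwise disjoint family $B_\gamma$ of sets refining $A_\gamma$ (each member of $B_\gamma$ is contained in a member of $A_\gamma$).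 TWO wins the play if $\bigcup_{\gamma<\beta}B_\gamma$ is an open cover of $X$; otherwise ONE wins. ${\sf tp}_{{\sf S}_c(\mathcal{O},\mathcal{O})}(X)$ is the least $\beta$ such that TWO has a winning strategy in this game on $X$. The game dimension $\dim_G(X)$ is defined by $1+\dim_G(X)={\sf tp}_{{\sf S}_c(\mathcal{O},\mathcal{O})}(X)$ (so $\dim_G(\emptyset)=-1$). *)

theory Defs
  imports "HOL-Analysis.Analysis"
begin

unbundle cardinal_syntax

section \<open>Ordinals\<close>

text \<open>
  Ordinals are represented, as in the library, by well-order relations
  (\<^term>\<open>Well_order r\<close>), compared by \<open>\<le>o\<close> and \<open>=o\<close>. The ordinals
  \<open>1\<close> and \<open>\<omega>\<close> are \<^term>\<open>natLeq_on 1\<close> and \<^term>\<open>natLeq\<close>, and \<open>0\<close> is the empty relation.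
\<close>

definition ord_sum :: "'i rel \<Rightarrow> 'j rel \<Rightarrow> ('i + 'j) rel" (infixl "+\<^sub>o" 65)
  where "r +\<^sub>o s = dir_image r Inl \<union> dir_image s Inr \<union> (Inl ` Field r) \<times> (Inr ` Field s)"

definition limit_ordinal :: "'i rel \<Rightarrow> bool"
  where "limit_ordinal r \<longleftrightarrow>
    Well_order r \<and> r \<noteq> {} \<and> (\<forall>i \<in> Field r. \<exists>j \<in> Field r. j \<noteq> i \<and> (i, j) \<in> r)"

text \<open>
  The choice is between isomorphic well-orders. All lengths smaller than a given well-order
  on \<open>'a\<close> are realised by its initial segments, so that, as soon as some well-order on \<open>'a\<close>
  satisfies an isomorphism-invariant property \<open>P\<close>, the result is the least of all ordinals
  satisfying \<open>P\<close>, not just of those carried by \<open>'a\<close>.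
\<close>
definition least_ordinal :: "('a rel \<Rightarrow> bool) \<Rightarrow> 'a rel"
  where "least_ordinal P = (SOME r. Well_order r \<and> P r \<and> (\<forall>s. Well_order s \<and> P s \<longrightarrow> r \<le>o s))"

section \<open>Covers and covering dimension\<close>

definition open_covers :: "'a topology \<Rightarrow> 'a set set set"
  where "open_covers X = {\<U>. (\<forall>U \<in> \<U>. openin X U) \<and> \<Union>\<U> = topspace X}"

definition refines :: "'a set set \<Rightarrow> 'a set set \<Rightarrow> bool"
  where "refines \<V> \<U> \<longleftrightarrow> (\<forall>V \<in> \<V>. \<exists>U \<in> \<U>. V \<subseteq> U)"

definition covering_dim_le :: "'a topology \<Rightarrow> nat \<Rightarrow> bool"
  where "covering_dim_le X n \<longleftrightarrow>
    (\<forall>\<U> \<in> open_covers X. finite \<U> \<longrightarrow>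
      (\<exists>\<V> \<in> open_covers X. finite \<V> \<and> refines \<V> \<U> \<and>
        (\<forall>x \<in> topspace X. card {V \<in> \<V>. x \<in> V} \<le> n + 1)))"

definition finite_dimensional :: "'a topology \<Rightarrow> bool"
  where "finite_dimensional X \<longleftrightarrow> (\<exists>n. covering_dim_le X n)"

definition kfd_covers :: "'a topology \<Rightarrow> 'a set set set"
  where "kfd_covers X = {\<U> \<in> open_covers X.
    \<forall>T. compactin X T \<and> finite_dimensional (subtopology X T) \<longrightarrow> (\<exists>U \<in> \<U>. T \<subseteq> U)}"

section \<open>Games of ordinal length\<close>

text \<open>
  The innings are the elements of \<^term>\<open>Field r\<close>. In inning \<open>\<gamma>\<close> a strategy \<open>F\<close> of TWO sees
  \<open>\<gamma>\<close> and the moves of ONE in the innings up to and including \<open>\<gamma>\<close>. TWO's own earlier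
  moves are determined by these. It is enough to consider complete plays of ONE, since the
  legality of a move of ONE does not depend on the other moves.
\<close>
definition TWO_wins ::
  "'i rel \<Rightarrow> 'm set \<Rightarrow> ('m \<Rightarrow> 'n \<Rightarrow> bool) \<Rightarrow> ('n set \<Rightarrow> bool) \<Rightarrow> bool"
  where "TWO_wins r moves legal win \<longleftrightarrow>
    (\<exists>F :: 'i \<Rightarrow> ('i \<Rightarrow> 'm) \<Rightarrow> 'n. \<forall>A. (\<forall>\<gamma> \<in> Field r. A \<gamma> \<in> moves) \<longrightarrow>
      (\<forall>\<gamma> \<in> Field r. legal (A \<gamma>) (F \<gamma> (restrict A (under r \<gamma>)))) \<and>
      win ((\<lambda>\<gamma>. F \<gamma> (restrict A (under r \<gamma>))) ` Field r))"

definition TWO_wins_G1_kfd :: "'a topology \<Rightarrow> 'i rel \<Rightarrow> bool"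
  where "TWO_wins_G1_kfd X r \<longleftrightarrow>
    TWO_wins r (kfd_covers X) (\<lambda>A B. B \<in> A) (\<lambda>\<B>. \<B> \<in> open_covers X)"

definition TWO_wins_Gc :: "'a topology \<Rightarrow> 'i rel \<Rightarrow> bool"
  where "TWO_wins_Gc X r \<longleftrightarrow>
    TWO_wins r (open_covers X) (\<lambda>A B. pairwise disjnt B \<and> refines B A)
      (\<lambda>\<B>. \<Union>\<B> \<in> open_covers X)"

text \<open>
  The type of points carries long enough well-orders, since TWO wins both games
  when the innings are the points of the space.
\<close>
definition tp_S1_kfd :: "'a topology \<Rightarrow> 'a rel"
  where "tp_S1_kfd X = least_ordinal (TWO_wins_G1_kfd X)"

definition tp_Sc :: "'a topology \<Rightarrow> 'a rel"
  where "tp_Sc X = least_ordinal (TWO_wins_Gc X)"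

text \<open>\<^term>\<open>None\<close> stands for the dimension \<open>-1\<close>, which is not an ordinal.\<close>
definition game_dim :: "'a topology \<Rightarrow> 'a rel option"
  where "game_dim X = (if topspace X = {} then None
    else Some (SOME \<delta>. Well_order \<delta> \<and> natLeq_on 1 +\<^sub>o \<delta> =o tp_Sc X))"

definition game_dim_le :: "'a topology \<Rightarrow> 'i rel \<Rightarrow> bool"
  where "game_dim_le X r \<longleftrightarrow> (case game_dim X of None \<Rightarrow> True | Some \<delta> \<Rightarrow> \<delta> \<le>o r)"

section \<open>Well-definedness\<close>

lemma Field_ord_sum: "Field (r +\<^sub>o s) = Inl ` Field r \<union> Inr ` Field s"
  unfolding ord_sum_def Field_Un dir_image_Field by (auto simp: Field_def)

lemma in_ord_sum [simp]:
  "(Inl a, Inl b) \<in> r +\<^sub>o s \<longleftrightarrow> (a, b) \<in> r"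
  "(Inr c, Inr d) \<in> r +\<^sub>o s \<longleftrightarrow> (c, d) \<in> s"
  "(Inl a, Inr d) \<in> r +\<^sub>o s \<longleftrightarrow> a \<in> Field r \<and> d \<in> Field s"
  "(Inr c, Inl b) \<notin> r +\<^sub>o s"
  unfolding ord_sum_def dir_image_def by auto

lemma Well_order_ord_sum:
  assumes "Well_order r" "Well_order s"
  shows "Well_order (r +\<^sub>o s)"
proof -
  have r: "Refl r" "trans r" "antisym r" "Total r" "wf (r - Id)"
    and s: "Refl s" "trans s" "antisym s" "Total s" "wf (s - Id)"
    using assms by (auto simp: order_on_defs)
  have "Refl (r +\<^sub>o s)"
    using r(1) s(1) by (auto simp: refl_on_def Field_ord_sum)
  moreover have "trans (r +\<^sub>o s)"
  proof (rule transI)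
    fix x y z assume "(x, y) \<in> r +\<^sub>o s" "(y, z) \<in> r +\<^sub>o s"
    then show "(x, z) \<in> r +\<^sub>o s"
      by (cases x; cases y; cases z; simp; meson r(2) s(2) transD FieldI1 FieldI2)
  qed
  moreover have "antisym (r +\<^sub>o s)"
  proof (rule antisymI)
    fix x y assume "(x, y) \<in> r +\<^sub>o s" "(y, x) \<in> r +\<^sub>o s"
    then show "x = y"
      by (cases x; cases y) (auto dest: antisymD[OF r(3)] antisymD[OF s(3)])
  qed
  moreover have "Total (r +\<^sub>o s)"
    using r(4) s(4) unfolding total_on_def Field_ord_sum by (auto; blast)
  moreover have "wf (r +\<^sub>o s - Id)"
  proof (rule wfUNIVI)
    fix P x assume step: "\<forall>x. (\<forall>y. (y, x) \<in> r +\<^sub>o s - Id \<longrightarrow> P y) \<longrightarrow> P x"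
    have l: "P (Inl a)" for a
    proof (induction a rule: wf_induct_rule[OF r(5)])
      case (1 a)
      have "P y" if "(y, Inl a) \<in> r +\<^sub>o s - Id" for y
        using that 1 by (cases y) auto
      then show ?case using step by blast
    qed
    have "P (Inr b)" for b
    proof (induction b rule: wf_induct_rule[OF s(5)])
      case (1 b)
      have "P y" if "(y, Inr b) \<in> r +\<^sub>o s - Id" for y
        using that 1 l by (cases y) auto
      then show ?case using step by blast
    qed
    with l show "P x" by (cases x) auto
  qed
  ultimately show ?thesis by (auto simp: order_on_defs Field_def)
qed

lemma least_ordinal:
  assumes "Well_order r" "P r"
  shows "Well_order (least_ordinal P) \<and> P (least_ordinal P) \<and>
    (\<forall>s. Well_order s \<and> P s \<longrightarrow> least_ordinal P \<le>o s)"
proof -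
  have "\<exists>r \<in> {r. Well_order r \<and> P r}. \<forall>s \<in> {r. Well_order r \<and> P r}. r \<le>o s"
    by (rule exists_minim_Well_order) (use assms in auto)
  then have "\<exists>r. Well_order r \<and> P r \<and> (\<forall>s. Well_order s \<and> P s \<longrightarrow> r \<le>o s)"
    by simp
  from someI_ex[OF this] show ?thesis
    unfolding least_ordinal_def .
qed

lemma TWO_wins_pointwise:
  assumes pts: "Field r = topspace X" and r: "Well_order r"
    and moves: "moves \<subseteq> open_covers X"
    and G: "\<And>A U. A \<in> moves \<Longrightarrow> U \<in> A \<Longrightarrow> legal A (G U)"
    and win: "\<And>\<U>. \<U> \<in> open_covers X \<Longrightarrow> win (G ` \<U>)"
  shows "TWO_wins r moves legal win"
proof -
  define U where "U \<gamma> \<A> = (SOME U. U \<in> \<A> \<and> \<gamma> \<in> U)" for \<gamma> :: 'a and \<A> :: "'a set set"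
  define F where "F \<gamma> h = G (U \<gamma> (h \<gamma>))" for \<gamma> h
  have "(\<forall>\<gamma> \<in> Field r. legal (A \<gamma>) (F \<gamma> (restrict A (under r \<gamma>)))) \<and>
      win ((\<lambda>\<gamma>. F \<gamma> (restrict A (under r \<gamma>))) ` Field r)"
    if A: "\<forall>\<gamma> \<in> Field r. A \<gamma> \<in> moves" for A
  proof -
    have F: "F \<gamma> (restrict A (under r \<gamma>)) = G (U \<gamma> (A \<gamma>))" if "\<gamma> \<in> Field r" for \<gamma>
    proof -
      have "(\<gamma>, \<gamma>) \<in> r"
        using r that by (auto simp: order_on_defs refl_on_def)
      then show ?thesis by (simp add: F_def under_def)
    qed
    have A': "A \<gamma> \<in> open_covers X" if "\<gamma> \<in> Field r" for \<gamma>
      using A that moves by auto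
    have U: "U \<gamma> (A \<gamma>) \<in> A \<gamma> \<and> \<gamma> \<in> U \<gamma> (A \<gamma>)" if "\<gamma> \<in> Field r" for \<gamma>
    proof -
      have "\<gamma> \<in> \<Union>(A \<gamma>)" using A'[OF that] that pts by (auto simp: open_covers_def)
      then have "\<exists>V. V \<in> A \<gamma> \<and> \<gamma> \<in> V" by blast
      from someI_ex[OF this] show ?thesis unfolding U_def .
    qed
    have op: "openin X (U \<gamma> (A \<gamma>))" if "\<gamma> \<in> Field r" for \<gamma>
      using A' U that by (auto simp: open_covers_def)
    have "\<Union>((\<lambda>\<gamma>. U \<gamma> (A \<gamma>)) ` Field r) = topspace X"
    proof
      show "\<Union>((\<lambda>\<gamma>. U \<gamma> (A \<gamma>)) ` Field r) \<subseteq> topspace X"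
        using op openin_subset by blast
      show "topspace X \<subseteq> \<Union>((\<lambda>\<gamma>. U \<gamma> (A \<gamma>)) ` Field r)"
        using U pts by blast
    qed
    then have "(\<lambda>\<gamma>. U \<gamma> (A \<gamma>)) ` Field r \<in> open_covers X"
      using op by (auto simp: open_covers_def)
    then have "win (G ` (\<lambda>\<gamma>. U \<gamma> (A \<gamma>)) ` Field r)" by (rule win)
    moreover have "(\<lambda>\<gamma>. F \<gamma> (restrict A (under r \<gamma>))) ` Field r
        = G ` (\<lambda>\<gamma>. U \<gamma> (A \<gamma>)) ` Field r"
      unfolding image_image by (rule image_cong) (simp_all add: F)
    moreover have "\<forall>\<gamma> \<in> Field r. legal (A \<gamma>) (F \<gamma> (restrict A (under r \<gamma>)))"
    proof
      fix \<gamma> assume \<gamma>: "\<gamma> \<in> Field r"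
      show "legal (A \<gamma>) (F \<gamma> (restrict A (under r \<gamma>)))"
        unfolding F[OF \<gamma>] using A \<gamma> U[OF \<gamma>] by (intro G) blast+
    qed
    ultimately show ?thesis by simp
  qed
  then show ?thesis unfolding TWO_wins_def by blast
qed

lemma tp_S1_kfd:
  fixes X :: "'a topology" and s :: "'a rel"
  shows "Well_order (tp_S1_kfd X)" "TWO_wins_G1_kfd X (tp_S1_kfd X)"
  "Well_order s \<Longrightarrow> TWO_wins_G1_kfd X s \<Longrightarrow> tp_S1_kfd X \<le>o s"
proof -
  obtain r where "well_order_on (topspace X) r"
    using well_order_on by blast
  then have r: "Well_order r" "Field r = topspace X"
    by (auto dest: well_order_on_Well_order)
  have "TWO_wins_G1_kfd X r"
    unfolding TWO_wins_G1_kfd_def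
    by (rule TWO_wins_pointwise[where G = "\<lambda>U. U" and X = X])
       (use r in \<open>auto simp: kfd_covers_def\<close>)
  from least_ordinal[of r "TWO_wins_G1_kfd X", OF r(1) this] show
    "Well_order (tp_S1_kfd X)" "TWO_wins_G1_kfd X (tp_S1_kfd X)"
    "Well_order s \<Longrightarrow> TWO_wins_G1_kfd X s \<Longrightarrow> tp_S1_kfd X \<le>o s"
    unfolding tp_S1_kfd_def by auto
qed

lemma tp_Sc:
  fixes X :: "'a topology" and s :: "'a rel"
  shows "Well_order (tp_Sc X)" "TWO_wins_Gc X (tp_Sc X)"
  "Well_order s \<Longrightarrow> TWO_wins_Gc X s \<Longrightarrow> tp_Sc X \<le>o s"
proof -
  obtain r where "well_order_on (topspace X) r"
    using well_order_on by blast
  then have r: "Well_order r" "Field r = topspace X"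
    by (auto dest: well_order_on_Well_order)
  have "TWO_wins_Gc X r"
    unfolding TWO_wins_Gc_def
    by (rule TWO_wins_pointwise[where G = "\<lambda>U. {U}" and X = X])
       (use r in \<open>auto simp: refines_def\<close>)
  from least_ordinal[of r "TWO_wins_Gc X", OF r(1) this] show
    "Well_order (tp_Sc X)" "TWO_wins_Gc X (tp_Sc X)"
    "Well_order s \<Longrightarrow> TWO_wins_Gc X s \<Longrightarrow> tp_Sc X \<le>o s"
    unfolding tp_Sc_def by auto
qed

lemma one_plus_ordinal_exists:
  fixes r :: "'a rel"
  assumes r: "Well_order r" and ne: "r \<noteq> {}"
  shows "\<exists>\<delta> :: 'a rel. Well_order \<delta> \<and> natLeq_on 1 +\<^sub>o \<delta> =o r"
proof -
  interpret wo_rel r using r by (simp add: wo_rel_def)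
  define m where "m = minim (Field r)"
  have "Field r \<noteq> {}" using ne by (auto simp: Field_def)
  then have m: "m \<in> Field r" "\<And>x. x \<in> Field r \<Longrightarrow> (m, x) \<in> r"
    unfolding m_def using minim_in minim_least by auto
  define \<delta> where "\<delta> = Restr r (Field r - {m})"
  have \<delta>: "Well_order \<delta>" unfolding \<delta>_def by (rule Well_order_Restr[OF r])
  have F\<delta>: "Field \<delta> = Field r - {m}"
    unfolding \<delta>_def using Refl_Field_Restr2[OF REFL, of "Field r - {m}"] by blast
  have in_\<delta>: "(x, y) \<in> \<delta> \<longleftrightarrow> (x, y) \<in> r \<and> x \<in> Field r - {m} \<and> y \<in> Field r - {m}" for x y
    by (auto simp: \<delta>_def)
  have one: "Well_order (natLeq_on 1)" by (rule natLeq_on_Well_order)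
  have F1: "Field {(x :: nat, y). x = 0 \<and> y = 0 \<and> x \<le> y} = {0}" by (auto simp: Field_def)
  define f where "f = case_sum (\<lambda>_ :: nat. m) (\<lambda>x. x)"
  have "bij_betw f (Field (natLeq_on 1 +\<^sub>o \<delta>)) (Field r)"
    using m(1) unfolding bij_betw_def Field_ord_sum F\<delta> Field_natLeq_on f_def
    by (auto simp: inj_on_def image_Un image_image)
  moreover have "(x, y) \<in> natLeq_on 1 +\<^sub>o \<delta> \<longleftrightarrow> (f x, f y) \<in> r"
    if "x \<in> Field (natLeq_on 1 +\<^sub>o \<delta>)" "y \<in> Field (natLeq_on 1 +\<^sub>o \<delta>)" for x y
  proof (cases x; cases y)
    fix a b assume *: "x = Inr a" "y = Inl b"
    then have "a \<in> Field r" "a \<noteq> m" using that F\<delta> by (auto simp: Field_ord_sum)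
    then have "(a, m) \<notin> r" using m antisymD[OF ANTISYM] by blast
    then show ?thesis using * by (simp add: f_def)
  qed (use that m in \<open>auto simp: f_def Field_ord_sum F1 F\<delta> in_\<delta>\<close>)
  ultimately have "iso (natLeq_on 1 +\<^sub>o \<delta>) r f"
    using iso_iff2 by blast
  then have "natLeq_on 1 +\<^sub>o \<delta> =o r"
    unfolding ordIso_def using Well_order_ord_sum[OF one \<delta>] r by blast
  with \<delta> show ?thesis by blast
qed

lemma game_dim:
  assumes "topspace X \<noteq> {}"
  obtains \<delta> where "game_dim X = Some \<delta>" "Well_order \<delta>" "natLeq_on 1 +\<^sub>o \<delta> =o tp_Sc X"
proof -
  have "{} \<notin> open_covers X" using assms unfolding open_covers_def by fastforce
  moreover have "\<exists>\<A>. \<A> \<in> open_covers X"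
    by (rule exI[of _ "{topspace X}"]) (auto simp: open_covers_def)
  ultimately have "tp_Sc X \<noteq> {}"
    using tp_Sc(2)[of X] by (auto simp: TWO_wins_Gc_def TWO_wins_def)
  from someI_ex[OF one_plus_ordinal_exists[OF tp_Sc(1) this]] assms that show thesis
    by (simp add: game_dim_def)
qed

end

theory Submission
  imports Defs
begin

text \<open>The order of decisions is the obstacle. TWO commits to the pieces of K, and hence to the
  number of innings spent on it, before seeing the covers that ONE plays in these innings. So the
  pieces cannot be fitted to a cover. They act as the zero-dimensional summands of a finite
  dimensional space, but are built directly from the covering definition: at each of a sequence of
  scales tending to 0, K is covered by n + 1 families of small sets, each family separated by a
  positive gap, and \<open>Z j\<close> collects the points met by family j at infinitely many
  scales. No single scale would do, since ONE may play a finer cover; and since sets of different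
  scales overlap, they have to be merged into disjoint ones without becoming large.

  The number of pieces varies with K and no bound is known, so a fixed finite multiple of the length
  would not suffice. The match is made between consecutive limits instead: \<omega> innings leave
  room for \<omega> finite runs. As K depends on the finished neighbourhoods of its predecessors,
  one run has to end before the next begins.\<close>

text \<open>
  A winning strategy of TWO in the game on \<^term>\<open>kfd_covers X\<close> amounts to a choice of compact
  finite dimensional sets \<open>K\<close>, each depending on the neighbourhoods chosen for the earlier
  ones, such that all the chosen neighbourhoods together cover \<open>X\<close>. In the other game, TWO can
  produce a neighbourhood of such a \<open>K\<close> in finitely many innings: \<open>K\<close> is a union of
  finitely many sets \<open>Z j\<close>, each of which, whatever open cover ONE plays, is covered by a
  disjoint open family refining it. Replacing every inning by finitely many does not change a
  length that is a limit ordinal, and if \<open>\<alpha>\<close> is not a limit then \<open>\<alpha> + \<omega>\<close> is one.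
\<close>

section \<open>Decomposition of compact finite dimensional sets\<close>


text \<open>A form of zero-dimensionality of Z relative to X: Z does not depend on the cover, and
  the disjoint families are open in X rather than in Z, because TWO's moves must add up to an open
  cover of X.\<close>

definition thin_in :: "'a topology \<Rightarrow> 'a set \<Rightarrow> bool"
  where "thin_in X Z \<longleftrightarrow> (\<forall>\<A> \<in> open_covers X. \<exists>\<B>. pairwise disjnt \<B> \<and> refines \<B> \<A> \<and>
    (\<forall>B \<in> \<B>. openin X B) \<and> Z \<subseteq> \<Union>\<B>)"

section \<open>Separated families at one scale\<close>

text \<open>If all inclusions from \<open>T 0\<close> to \<open>T (Suc n)\<close> were strict, the n
  + 1 drops in cardinality would exhaust a set of at most n + 1 elements.\<close>

lemma decseq_consecutive_eq:
  fixes T :: "nat \<Rightarrow> 'b set"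
  assumes "finite (T 0)" "card (T 0) \<le> Suc n" "T (Suc n) \<noteq> {}" "\<And>i. T (Suc i) \<subseteq> T i"
  obtains i where "i \<le> n" "T i = T (Suc i)"
proof -
  have sub: "T i \<subseteq> T 0" for i
    by (induction i) (use assms(4) in blast)+
  have "card (T i) + i \<le> Suc n" if "i \<le> Suc n" "\<forall>j<i. T j \<noteq> T (Suc j)" for i
    using that
  proof (induction i)
    case (Suc i)
    then have "T (Suc i) \<subset> T i" using assms(4) by blast
    then have "card (T (Suc i)) < card (T i)"
      by (rule psubset_card_mono[OF finite_subset[OF sub assms(1)]])
    with Suc show ?case by simp
  qed (use assms in auto)
  from this[of "Suc n"] have "\<not> (\<forall>j<Suc n. T j \<noteq> T (Suc j))"
    using assms(3) finite_subset[OF sub assms(1)] by auto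
  then show thesis using that by (auto simp: less_Suc_eq_le)
qed

context Metric_space
begin

lemma lebesgue_number:
  assumes "compactin mtopology K" "\<And>U. U \<in> \<U> \<Longrightarrow> openin mtopology U" "K \<subseteq> \<Union>\<U>"
  obtains e where "e > 0" "\<And>x. x \<in> K \<Longrightarrow> \<exists>U \<in> \<U>. mball x e \<subseteq> U"
proof -
  have KM: "K \<subseteq> M" using assms(1) compactin_subset_topspace by fastforce
  have "\<exists>r>0. \<exists>U\<in>\<U>. mball x (2 * r) \<subseteq> U" if x: "x \<in> K" for x
  proof -
    obtain U where U: "U \<in> \<U>" "x \<in> U" using assms(3) x by blast
    then obtain r where "r > 0" "mball x r \<subseteq> U"
      using assms(2) unfolding openin_mtopology by meson
    with U show ?thesis by (intro exI[of _ "r / 2"]) auto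
  qed
  then obtain r where r: "\<And>x. x \<in> K \<Longrightarrow> r x > 0 \<and> (\<exists>U\<in>\<U>. mball x (2 * r x) \<subseteq> U)"
    by metis
  have "\<exists>F. finite F \<and> F \<subseteq> (\<lambda>x. mball x (r x)) ` K \<and> K \<subseteq> \<Union>F"
    by (rule compactinD[OF assms(1)]) (use KM r in auto)
  then obtain F where F: "finite F" "F \<subseteq> (\<lambda>x. mball x (r x)) ` K" "K \<subseteq> \<Union>F" by blast
  obtain C where C: "C \<subseteq> K" "finite C" "F = (\<lambda>x. mball x (r x)) ` C"
    using finite_subset_image[OF F(1,2)] by blast
  \<comment> \<open>The 1 only keeps the minimum defined when K, and hence possibly C, is
    empty.\<close>
  define e where "e = Min (insert 1 (r ` C))"
  have "e > 0" using C r by (auto simp: e_def)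
  moreover have "\<exists>U\<in>\<U>. mball x e \<subseteq> U" if x: "x \<in> K" for x
  proof -
    obtain c where c: "c \<in> C" "x \<in> mball c (r c)" using C(3) F(3) x by blast
    then have "e \<le> r c" using C(2) by (simp add: e_def)
    have "mball x e \<subseteq> mball c (2 * r c)"
    proof
      fix y assume y: "y \<in> mball x e"
      then have "d c y \<le> d c x + d x y" using c by (intro triangle) auto
      then show "y \<in> mball c (2 * r c)" using c y \<open>e \<le> r c\<close> by auto
    qed
    then show ?thesis using r[of c] c C(1) by blast
  qed
  ultimately show thesis using that by blast
qed

text \<open>
  The sets \<open>T i x\<close> of members of a cover of order at most \<open>n + 1\<close> that contain the ball of
  radius \<open>(i + 1) \<cdot> e\<close> around \<open>x\<close> decrease with \<open>i\<close>, hence \<open>T i x = T (i + 1) x\<close> for some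
  \<open>i \<le> n\<close>. For fixed \<open>i\<close>, points at distance less than \<open>e\<close> with this property
  have the same \<open>T i\<close>.
\<close>
lemma separated_families:
  assumes K: "compactin mtopology K" and dim: "covering_dim_le (subtopology mtopology K) n"
    and m: "m > 0"
  shows "\<exists>\<W> \<delta>. \<delta> > 0 \<and> K \<subseteq> (\<Union>i\<le>n. \<Union>(\<W> i)) \<and>
    (\<forall>i. \<forall>B\<in>\<W> i. openin mtopology B \<and> (\<forall>x\<in>B. \<forall>y\<in>B. d x y \<le> m) \<and>
      (\<forall>B'\<in>\<W> i. B \<noteq> B' \<longrightarrow> (\<forall>x\<in>B. \<forall>y\<in>B'. \<delta> \<le> d x y)))"
proof -
  have KM: "K \<subseteq> M" using K compactin_subset_topspace by fastforce
  \<comment> \<open>Radius m / 4 gives the refinement diameters of at most m / 2; the other half of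
    m is reserved for the later enlargement by e / 4 at both ends.\<close>
  have "\<exists>F. finite F \<and> F \<subseteq> (\<lambda>x. mball x (m / 4)) ` K \<and> K \<subseteq> \<Union>F"
    by (rule compactinD[OF K]) (use KM m in auto)
  then obtain F where F: "finite F" "F \<subseteq> (\<lambda>x. mball x (m / 4)) ` K" "K \<subseteq> \<Union>F"
    by blast
  have top: "topspace (subtopology mtopology K) = K" using KM by auto
  have "(\<inter>) K ` F \<in> open_covers (subtopology mtopology K)"
  proof -
    have "openin (subtopology mtopology K) (K \<inter> U)" if "U \<in> F" for U
    proof -
      have "openin mtopology U" using F(2) that by auto
      then show ?thesis by (rule openin_subtopology_Int2)
    qed
    moreover have "\<Union>((\<inter>) K ` F) = K" using F(3) by blast
    ultimately show ?thesis unfolding open_covers_def top by blast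
  qed
  with dim F(1) obtain \<V> where V: "\<V> \<in> open_covers (subtopology mtopology K)" "finite \<V>"
    "refines \<V> ((\<inter>) K ` F)" "\<And>x. x \<in> K \<Longrightarrow> card {V \<in> \<V>. x \<in> V} \<le> n + 1"
    unfolding covering_dim_le_def top by blast
  have Vdiam: "d x y \<le> m / 2" if "V \<in> \<V>" "x \<in> V" "y \<in> V" for V x y
  proof -
    have "\<exists>W \<in> (\<inter>) K ` F. V \<subseteq> W" using V(3) that(1) unfolding refines_def by (rule bspec)
    then obtain U where U: "U \<in> F" "V \<subseteq> K \<inter> U" by (elim bexE imageE) simp
    obtain c where "U = mball c (m / 4)" using F(2) U(1) by (elim subsetD[THEN imageE])
    with U(2) have c: "x \<in> mball c (m / 4)" "y \<in> mball c (m / 4)"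
      using that(2,3) by (simp_all add: subset_iff del: in_mball)
    then have "d x y \<le> d x c + d c y" by (intro triangle) auto
    then show ?thesis using c by (simp add: commute)
  qed
  \<comment> \<open>Members of \<V> are open only in K. Passing to open sets of X with traces in
    \<V> gives a Lebesgue number for balls of the whole space.\<close>
  define \<U> where "\<U> = {U. openin mtopology U \<and> K \<inter> U \<in> \<V>}"
  have "K \<subseteq> \<Union>\<U>"
  proof
    fix x assume "x \<in> K"
    then obtain V where "V \<in> \<V>" "x \<in> V" using V(1) top by (auto simp: open_covers_def)
    moreover then obtain U where "openin mtopology U" "V = K \<inter> U"
      using V(1) by (auto simp: open_covers_def openin_subtopology Int_commute)
    ultimately show "x \<in> \<Union>\<U>" by (auto simp: \<U>_def)
  qed
  then obtain l where l: "l > 0" "\<And>x. x \<in> K \<Longrightarrow> \<exists>U \<in> \<U>. mball x l \<subseteq> U"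
    using lebesgue_number[OF K, of \<U>] by (auto simp: \<U>_def)
  \<comment> \<open>The pigeonhole needs \<open>T (Suc n) x\<close> to be nonempty. Its radius is (n
    + 2) * e, which therefore must not exceed l.\<close>
  define e where "e = min (m / 2) (l / (n + 2))"
  have "e > 0" "e \<le> m / 2" "e \<le> l / (n + 2)" 
    using m l(1) unfolding e_def by (simp, intro min.cobounded1, intro min.cobounded2)
  then have e: "e > 0" "e \<le> m / 2" "(n + 2) * e \<le> l"
    by (simp_all add: pos_le_divide_eq mult.commute)
  define T where "T i x = {V \<in> \<V>. K \<inter> mball x ((i + 1) * e) \<subseteq> V}" for i :: nat and x
  have T_contains: "x \<in> V" if "V \<in> T i x" "x \<in> K" for V i x
    using that e(1) KM by (auto simp: T_def)
  have T_shift: "T (Suc i) x \<subseteq> T i y" if "x \<in> K" "y \<in> K" "d x y < e" for i x y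
  proof -
    have "mball y ((i + 1) * e) \<subseteq> mball x ((Suc i + 1) * e)"
    proof
      fix z assume z: "z \<in> mball y ((i + 1) * e)"
      then have "d x z \<le> d x y + d y z" using that KM by (intro triangle) auto
      then show "z \<in> mball x ((Suc i + 1) * e)"
        using z that KM by (auto simp: algebra_simps)
    qed
    then show ?thesis unfolding T_def by blast
  qed
  define R where "R i S = {x \<in> K. T i x = S \<and> T (Suc i) x = S}" for i :: nat and S
  have R_sep: "S = S'" if "x \<in> R i S" "y \<in> R i S'" "d x y < e" for x y i S S'
    using T_shift[of x y i] T_shift[of y x i] that commute unfolding R_def by auto
  \<comment> \<open>For fixed i, the sets \<open>R i S\<close> are at least e apart. Radius e / 4
    makes them open and keeps half of the gap.\<close>
  define N where "N i S = (\<Union>x\<in>R i S. mball x (e / 4))" for i :: nat and S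
  \<comment> \<open>A member of S contains all of \<open>R i S\<close> and thus bounds its diameter;
    S = {} would give no bound. No point of K is lost, because l makes \<open>T i x\<close> nonempty
    for i \<le> n.\<close>
  define \<W> where "\<W> i = N i ` {S. S \<noteq> {}}" for i :: nat
  have N: "\<exists>x'\<in>R i S. d x x' \<le> e / 4 \<and> x \<in> M \<and> x' \<in> M" if "x \<in> N i S" for x i S
    using that by (auto simp: N_def commute intro!: bexI)
  have diam: "d x y \<le> m" if "S \<noteq> {}" and xy: "x \<in> N i S" "y \<in> N i S" for x y i S
  proof -
    obtain x' y' where *: "x' \<in> R i S" "y' \<in> R i S" "d x x' \<le> e / 4" "d y y' \<le> e / 4"
      "x \<in> M" "y \<in> M" "x' \<in> M" "y' \<in> M" using N[OF xy(1)] N[OF xy(2)] by blast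
    obtain V where "V \<in> S" using \<open>S \<noteq> {}\<close> by blast
    then have V: "V \<in> T i x'" "V \<in> T i y'" "x' \<in> K" "y' \<in> K" using * by (auto simp: R_def)
    have "d x' y' \<le> m / 2"
      using Vdiam[of V x' y'] T_contains[OF V(1,3)] T_contains[OF V(2,4)] V(1)
      unfolding T_def by blast
    moreover have "d x y \<le> d x x' + d x' y" "d x' y \<le> d x' y' + d y' y"
      using * by (auto intro: triangle)
    ultimately show ?thesis using * e(2) m commute[of y y'] by linarith
  qed
  have sep: "e / 2 \<le> d x y" if "S \<noteq> S'" and xy: "x \<in> N i S" "y \<in> N i S'" for x y i S S'
  proof -
    obtain x' y' where *: "x' \<in> R i S" "y' \<in> R i S'" "d x x' \<le> e / 4" "d y y' \<le> e / 4"
      "x \<in> M" "y \<in> M" "x' \<in> M" "y' \<in> M" using N[OF xy(1)] N[OF xy(2)] by blast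
    then have "e \<le> d x' y'" using R_sep[of x' i S y' S'] that(1) by linarith
    moreover have "d x' y' \<le> d x' x + d x y'" "d x y' \<le> d x y + d y y'"
      using * by (auto intro: triangle)
    ultimately show ?thesis using * commute[of x x'] by linarith
  qed
  have cover: "K \<subseteq> (\<Union>i\<le>n. \<Union>(\<W> i))"
  proof
    fix x assume x: "x \<in> K"
    then have "x \<in> M" using KM by blast
    obtain i where i: "i \<le> n" "T i x = T (Suc i) x"
    proof (rule decseq_consecutive_eq[of "\<lambda>i. T i x" n])
      show "finite (T 0 x)" using V(2) by (simp add: T_def)
      have "T 0 x \<subseteq> {V \<in> \<V>. x \<in> V}"
        using T_contains[OF _ x, of _ 0] unfolding T_def by blast
      then have "card (T 0 x) \<le> card {V \<in> \<V>. x \<in> V}" using V(2) by (intro card_mono) auto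
      then show "card (T 0 x) \<le> Suc n" using V(4)[OF x] by simp
      obtain U where U: "U \<in> \<U>" "mball x l \<subseteq> U" using l(2) x by blast
      have "mball x ((Suc n + 1) * e) \<subseteq> mball x l"
        using e(3) by (intro mball_subset_concentric) (simp add: algebra_simps)
      then have "K \<inter> U \<in> T (Suc n) x" using U by (auto simp: T_def \<U>_def)
      then show "T (Suc n) x \<noteq> {}" by blast
      show "T (Suc i) x \<subseteq> T i x" for i
        using T_shift[of x x i] x e(1) zero[of x x] \<open>x \<in> M\<close> by simp
    qed (rule that)
    obtain U where U: "U \<in> \<U>" "mball x l \<subseteq> U" using l(2) x by blast
    have "mball x ((i + 1) * e) \<subseteq> mball x l"
    proof (rule mball_subset_concentric)
      have "(i + 1) * e \<le> (n + 2) * e" using i(1) e(1) by (intro mult_right_mono) auto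
      then show "(i + 1) * e \<le> l" using e(3) by simp
    qed
    then have "K \<inter> U \<in> T i x" using U by (auto simp: T_def \<U>_def)
    then have "N i (T i x) \<in> \<W> i" by (auto simp: \<W>_def)
    moreover have "x \<in> N i (T i x)" 
      using i x e(1) \<open>x \<in> M\<close> unfolding N_def R_def by (auto intro!: bexI[of _ x])
    ultimately show "x \<in> (\<Union>i\<le>n. \<Union>(\<W> i))" using i(1) by blast
  qed
  have "\<forall>i. \<forall>B\<in>\<W> i. openin mtopology B \<and> (\<forall>x\<in>B. \<forall>y\<in>B. d x y \<le> m) \<and>
      (\<forall>B'\<in>\<W> i. B \<noteq> B' \<longrightarrow> (\<forall>x\<in>B. \<forall>y\<in>B'. e / 2 \<le> d x y))"
  proof (intro allI ballI conjI impI)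
    fix i B assume B: "B \<in> \<W> i"
    then show "openin mtopology B" by (auto simp: \<W>_def N_def)
    show "d x y \<le> m" if "x \<in> B" "y \<in> B" for x y
    proof -
      obtain S where "S \<noteq> {}" "B = N i S" using B by (auto simp: \<W>_def)
      then show ?thesis using diam that by blast
    qed
    show "e / 2 \<le> d x y" 
      if B': "B' \<in> \<W> i" and "B \<noteq> B'" "x \<in> B" "y \<in> B'" for B' x y
    proof -
      obtain S S' where S: "B = N i S" "B' = N i S'" using B B' by (auto simp: \<W>_def)
      then have "S \<noteq> S'" using that(2) by blast
      then show ?thesis using sep[of S S' x i y] that(3,4) unfolding S by simp
    qed
  qed
  with cover e(1) show ?thesis by (intro exI[of _ \<W>] exI[of _ "e / 2"]) simp
qed

section \<open>Linking the scales\<close>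

text \<open>A chain of members finer than scale k moves by at most 2 * m (k + 1), less than the gap
  \<delta> k, so it cannot join two different members of scale k. Hence a chain from scale k on
  needs at most one member of scale k, with a finer chain on either side: in total at most m k + 4 *
  m (k + 1), which is below 2 * m k.\<close>

lemma chain_diameter:
  fixes \<W> :: "nat \<Rightarrow> 'a set set" and m \<delta> :: "nat \<Rightarrow> real"
  assumes sub: "\<And>k B. B \<in> \<W> k \<Longrightarrow> B \<subseteq> M"
    and diam: "\<And>k B x y. B \<in> \<W> k \<Longrightarrow> x \<in> B \<Longrightarrow> y \<in> B \<Longrightarrow> d x y \<le> m k"
    and sep: "\<And>k B B' x y. B \<in> \<W> k \<Longrightarrow> B' \<in> \<W> k \<Longrightarrow> B \<noteq> B' \<Longrightarrow> x \<in> B \<Longrightarrow> y \<in> B' \<Longrightarrow> \<delta> k \<le> d x y"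
    and m: "\<And>k. m k > 0" "\<And>k. 8 * m (Suc k) \<le> m k" "\<And>k. 2 * m (Suc k) < \<delta> k"
    and chain: "(x, y) \<in> {(x, y). \<exists>i\<ge>k. \<exists>B\<in>\<W> i. x \<in> B \<and> y \<in> B}\<^sup>*" and "x \<in> M"
  shows "y \<in> M \<and> d x y \<le> 2 * m k"
proof -
  \<comment> \<open>A chain is finite and so involves only scales up to some N. This bound gives the
    induction, which descends in k, its start at k = N + 1, where no links are left.\<close>
  define E where "E k N = {(x, y). \<exists>i\<in>{k..N}. \<exists>B\<in>\<W> i. x \<in> B \<and> y \<in> B}" for k N
  have E_mono: "E k N \<subseteq> E k' N'" if "k' \<le> k" "N \<le> N'" for k k' N N'
    using that unfolding E_def by fastforce
  have bound: "\<forall>x\<in>M. \<forall>y. (x, y) \<in> (E k N)\<^sup>* \<longrightarrow> y \<in> M \<and> d x y \<le> 2 * m k" if "k \<le> Suc N" for k N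
    using that
  proof (induction k rule: inc_induct)
    case base
    have "E (Suc N) N = {}" by (auto simp: E_def)
    then show ?case using m(1)[of "Suc N"] by (auto intro: less_imp_le)
  next
    case (step k)
    have IH: "y \<in> M" "d x y \<le> 2 * m (Suc k)" if "(x, y) \<in> (E (Suc k) N)\<^sup>*" "x \<in> M" for x y
      using step.IH that by auto
    have *: "(x, y) \<in> (E (Suc k) N)\<^sup>* \<or> (\<exists>B\<in>\<W> k. \<exists>a\<in>B. \<exists>b\<in>B.
        (x, a) \<in> (E (Suc k) N)\<^sup>* \<and> (b, y) \<in> (E (Suc k) N)\<^sup>*)"
      if "(x, y) \<in> (E k N)\<^sup>*" for x y
      using that
    proof (induction rule: rtrancl_induct)
      case (step y z)
      then obtain i B where B: "i \<in> {k..N}" "B \<in> \<W> i" "y \<in> B" "z \<in> B"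
        unfolding E_def by blast
      show ?case
      proof (cases "i = k")
        case False
        then have "(y, z) \<in> E (Suc k) N" using B by (auto simp: E_def)
        then show ?thesis using step.IH by (meson rtrancl.rtrancl_into_rtrancl)
      next
        case True
        from step.IH show ?thesis
        proof
          assume "(x, y) \<in> (E (Suc k) N)\<^sup>*"
          then show ?thesis using B True by blast
        next
          assume "\<exists>B\<in>\<W> k. \<exists>a\<in>B. \<exists>b\<in>B.
            (x, a) \<in> (E (Suc k) N)\<^sup>* \<and> (b, y) \<in> (E (Suc k) N)\<^sup>*"
          then obtain B' a b where B': "B' \<in> \<W> k" "a \<in> B'" "b \<in> B'"
            "(x, a) \<in> (E (Suc k) N)\<^sup>*" "(b, y) \<in> (E (Suc k) N)\<^sup>*" by blast
          then have "d b y \<le> 2 * m (Suc k)" using IH sub by blast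
          \<comment> \<open>b and y are joined by a finer chain, hence closer than the gap. The step
            from y to z therefore stays in B', and z becomes its new exit point.\<close>
          then have "B' = B" using sep[of B' k B b y] B B' True m(3)[of k] by force
          then show ?thesis using B' B by blast
        qed
      qed
    qed simp
    show ?case
    proof (intro ballI allI impI)
      fix x y assume "x \<in> M" and xy: "(x, y) \<in> (E k N)\<^sup>*"
      from *[OF xy] show "y \<in> M \<and> d x y \<le> 2 * m k"
      proof
        assume "(x, y) \<in> (E (Suc k) N)\<^sup>*"
        then show ?thesis using IH[of x y] \<open>x \<in> M\<close> m(1,2)[of k] by auto
      next
        assume "\<exists>B\<in>\<W> k. \<exists>a\<in>B. \<exists>b\<in>B.
          (x, a) \<in> (E (Suc k) N)\<^sup>* \<and> (b, y) \<in> (E (Suc k) N)\<^sup>*"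
        then obtain B a b where B: "B \<in> \<W> k" "a \<in> B" "b \<in> B"
            "(x, a) \<in> (E (Suc k) N)\<^sup>*" "(b, y) \<in> (E (Suc k) N)\<^sup>*" by blast
        then have "a \<in> M" "b \<in> M" using sub by auto
        moreover have "y \<in> M" "d b y \<le> 2 * m (Suc k)" "d x a \<le> 2 * m (Suc k)" "d a b \<le> m k"
          using IH B \<open>b \<in> M\<close> \<open>x \<in> M\<close> diam by auto
        moreover have "d x y \<le> d x a + d a y" "d a y \<le> d a b + d b y"
          using \<open>x \<in> M\<close> calculation by (auto intro: triangle)
        ultimately show ?thesis using m(1,2)[of k] by auto
      qed
    qed
  qed
  from chain have "\<exists>N. (x, y) \<in> (E k N)\<^sup>*"
  proof (induction rule: rtrancl_induct)
    case (step y z)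
    then obtain N i B where *: "(x, y) \<in> (E k N)\<^sup>*" "i \<ge> k" "B \<in> \<W> i" "y \<in> B" "z \<in> B"
      by blast
    have "(y, z) \<in> E k (max N i)" using * by (auto simp: E_def)
    moreover have "(x, y) \<in> (E k (max N i))\<^sup>*"
      using *(1) rtrancl_mono[OF E_mono[of k k N "max N i"]] by auto
    ultimately show ?case by (meson rtrancl.rtrancl_into_rtrancl)
  qed auto
  then obtain N where "(x, y) \<in> (E k N)\<^sup>*" ..
  then have "(x, y) \<in> (E k (max N k))\<^sup>*"
    using rtrancl_mono[OF E_mono[of k k N "max N k"]] by auto
  then show ?thesis using bound[of k "max N k"] \<open>x \<in> M\<close> by auto
qed

text \<open>
  Points lying in members of a scale-\<open>k\<close> family for infinitely many \<open>k\<close> are covered by the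
  chain components of all members of scale at least \<open>k\<close>, which are open, disjoint and small.
\<close>
lemma compact_fd_thin_decomposition:
  assumes K: "compactin mtopology K" and fd: "finite_dimensional (subtopology mtopology K)"
  obtains n :: nat and Z where "K \<subseteq> (\<Union>j\<le>n. Z j)" "\<And>j. thin_in mtopology (Z j)"
proof -
  have KM: "K \<subseteq> M" using K compactin_subset_topspace by fastforce
  obtain n where n: "covering_dim_le (subtopology mtopology K) n"
    using fd by (auto simp: finite_dimensional_def)
  have "\<forall>m. \<exists>\<W> \<delta>. m > 0 \<longrightarrow> \<delta> > 0 \<and> K \<subseteq> (\<Union>i\<le>n. \<Union>(\<W> i)) \<and>
    (\<forall>i. \<forall>B\<in>\<W> i. openin mtopology B \<and> (\<forall>x\<in>B. \<forall>y\<in>B. d x y \<le> m) \<and>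
      (\<forall>B'\<in>\<W> i. B \<noteq> B' \<longrightarrow> (\<forall>x\<in>B. \<forall>y\<in>B'. \<delta> \<le> d x y)))"
    using separated_families[OF K n] by metis
  then obtain \<W> \<delta> where W: "\<And>m. m > 0 \<Longrightarrow> \<delta> m > 0 \<and> K \<subseteq> (\<Union>i\<le>n. \<Union>(\<W> m i)) \<and>
    (\<forall>i. \<forall>B\<in>\<W> m i. openin mtopology B \<and> (\<forall>x\<in>B. \<forall>y\<in>B. d x y \<le> m) \<and>
      (\<forall>B'\<in>\<W> m i. B \<noteq> B' \<longrightarrow> (\<forall>x\<in>B. \<forall>y\<in>B'. \<delta> m \<le> d x y)))"
    by metis
  \<comment> \<open>m / 8 is the decay that \<open>chain_diameter\<close> asks for, and \<delta> m /
    4 puts twice the next scale strictly below the present gap.\<close>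
  define m where "m = rec_nat 1 (\<lambda>_ m. min (m / 8) (\<delta> m / 4))"
  have m_Suc: "m (Suc k) = min (m k / 8) (\<delta> (m k) / 4)" for k by (simp add: m_def)
  have m: "m k > 0" for k
  proof (induction k)
    case 0 show ?case by (simp add: m_def)
  next
    case (Suc k) then show ?case using W[OF Suc] by (simp add: m_Suc)
  qed
  have m8: "8 * m (Suc k) \<le> m k" for k by (simp add: m_Suc min_def)
  have m\<delta>: "2 * m (Suc k) < \<delta> (m k)" for k
    using W[OF m[of k]] by (auto simp: m_Suc min_def)
  have Wopen: "openin mtopology B" if "B \<in> \<W> (m k) j" for B k j
    using W[OF m[of k]] that by blast
  have WM: "B \<subseteq> M" if "B \<in> \<W> (m k) j" for B k j
    using Wopen[OF that] openin_subset by fastforce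
  \<comment> \<open>At every scale x lies in one of finitely many families, so one index j recurs
    infinitely often. Then members around x exist beyond whatever scale a cover demands.\<close>
  define Z where "Z j = {x \<in> K. \<exists>\<^sub>\<infinity>k. x \<in> \<Union>(\<W> (m k) j)}" for j
  have cover: "K \<subseteq> (\<Union>j\<le>n. Z j)"
  proof
    fix x assume x: "x \<in> K"
    have "\<exists>j\<in>{..n}. x \<in> \<Union>(\<W> (m k) j)" for k
    proof -
      have "K \<subseteq> (\<Union>j\<le>n. \<Union>(\<W> (m k) j))" using W[OF m[of k]] by (elim conjE)
      then show ?thesis using x by blast
    qed
    then have "\<exists>\<^sub>\<infinity>k. \<exists>j\<in>{..n}. x \<in> \<Union>(\<W> (m k) j)"
      by simp
    then have "\<exists>j\<in>{..n}. \<exists>\<^sub>\<infinity>k. x \<in> \<Union>(\<W> (m k) j)"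
      unfolding frequently_bex_finite_distrib[OF finite_atMost] .
    then show "x \<in> (\<Union>j\<le>n. Z j)" using x by (auto simp: Z_def)
  qed
  have "thin_in mtopology (Z j)" for j
    unfolding thin_in_def
  proof
    fix \<A> assume A: "\<A> \<in> open_covers mtopology"
    obtain l where l: "l > 0" "\<And>x. x \<in> K \<Longrightarrow> \<exists>U\<in>\<A>. mball x l \<subseteq> U"
      using lebesgue_number[OF K, of \<A>] A KM by (auto simp: open_covers_def)
    have "m k \<le> (1 / 8) ^ k" for k
    proof (induction k)
      case 0 show ?case by (simp add: m_def)
    next
      case (Suc k) then show ?case using m8[of k] by simp
    qed
    moreover obtain k where "(1 / 8 :: real) ^ k < l / 2"
      using real_arch_pow_inv[of "l / 2" "1 / 8"] l(1) by auto
    ultimately have k: "2 * m k < l" 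
      by (metis le_less_trans mult.commute pos_less_divide_eq zero_less_numeral)
    define E where "E = {(x, y). \<exists>i\<ge>k. \<exists>B\<in>\<W> (m i) j. x \<in> B \<and> y \<in> B}"
    have small: "y \<in> M \<and> d x y \<le> 2 * m k" if "(x, y) \<in> E\<^sup>*" "x \<in> M" for x y
    proof (rule chain_diameter[of "\<lambda>k. \<W> (m k) j" m "\<lambda>k. \<delta> (m k)"])
      show "B \<subseteq> M" if "B \<in> \<W> (m k) j" for B k by (rule WM[OF that])
      show "d x y \<le> m k" if "B \<in> \<W> (m k) j" "x \<in> B" "y \<in> B" for k B x y
        using W[OF m[of k]] that by blast
      show "\<delta> (m k) \<le> d x y"
        if "B \<in> \<W> (m k) j" "B' \<in> \<W> (m k) j" "B \<noteq> B'" "x \<in> B" "y \<in> B'" for k B B' x y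
        using W[OF m[of k]] that by blast
    qed (use that m m8 m\<delta> in \<open>auto simp: E_def\<close>)
    have "sym E" by (auto simp: sym_def E_def)
    then have E: "(y, x) \<in> E\<^sup>*" if "(x, y) \<in> E\<^sup>*" for x y
      using that by (meson sym_rtrancl symD)
    have E_Z: "(x, x) \<in> E" if "x \<in> Z j" for x
      using that by (fastforce simp: Z_def E_def INFM_nat_le)
    \<comment> \<open>With \<open>E\<^sup>+\<close> each point of a class is the end of a link, so
      it lies in an open member contained in the class. Points of \<open>Z j\<close> are linked to
      themselves and so belong to their own class.\<close>
    define \<B> where "\<B> = (\<lambda>x. E\<^sup>+ `` {x}) ` Z j"
    have "pairwise disjnt \<B>"
    proof (rule pairwiseI)
      fix P Q assume "P \<in> \<B>" "Q \<in> \<B>" "P \<noteq> Q"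
      then obtain p q where pq: "P = E\<^sup>+ `` {p}" "Q = E\<^sup>+ `` {q}" by (auto simp: \<B>_def)
      show "disjnt P Q"
      proof (rule ccontr)
        assume "\<not> disjnt P Q"
        then obtain z where "(p, z) \<in> E\<^sup>+" "(q, z) \<in> E\<^sup>+" by (auto simp: disjnt_def pq)
        then have "(p, q) \<in> E\<^sup>*" "(q, p) \<in> E\<^sup>*"
          using E by (meson rtrancl_trans trancl_into_rtrancl)+
        then have "P = Q" by (auto simp: pq intro: rtrancl_trancl_trancl)
        with \<open>P \<noteq> Q\<close> show False ..
      qed
    qed
    moreover have "refines \<B> \<A>"
      unfolding refines_def
    proof
      fix P assume "P \<in> \<B>"
      then obtain p where p: "p \<in> Z j" "P = E\<^sup>+ `` {p}" by (auto simp: \<B>_def)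
      then have "p \<in> K" by (auto simp: Z_def)
      then have "p \<in> M" using KM by blast
      then have "P \<subseteq> mball p l" using small[of p] k p(2) by (fastforce dest: trancl_into_rtrancl)
      then show "\<exists>U\<in>\<A>. P \<subseteq> U" using l(2)[OF \<open>p \<in> K\<close>] by blast
    qed
    moreover have "openin mtopology P" if P: "P \<in> \<B>" for P
    proof (subst openin_subopen, intro ballI)
      fix y assume "y \<in> P"
      then obtain p where p: "P = E\<^sup>+ `` {p}" "(p, y) \<in> E\<^sup>+" using P by (auto simp: \<B>_def)
      then obtain w where "(w, y) \<in> E" by (meson tranclE)
      then obtain i B where B: "i \<ge> k" "B \<in> \<W> (m i) j" "y \<in> B" by (auto simp: E_def)
      then have "(y, z) \<in> E" if "z \<in> B" for z using that by (auto simp: E_def)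
      then have "B \<subseteq> P" using p by (auto intro: trancl_into_trancl)
      then show "\<exists>T. openin mtopology T \<and> y \<in> T \<and> T \<subseteq> P" using B Wopen by blast
    qed
    moreover have "Z j \<subseteq> \<Union>\<B>" using E_Z by (auto simp: \<B>_def)
    ultimately show "\<exists>\<B>. pairwise disjnt \<B> \<and> refines \<B> \<A> \<and>
        (\<forall>B \<in> \<B>. openin mtopology B) \<and> Z j \<subseteq> \<Union>\<B>" by blast
  qed
  with cover show thesis by (rule that)
qed

end

section \<open>Strategies\<close>


text \<open>Applied to points, it shows that open families capturing all compact finite dimensional
  sets are covers; applied to the empty set, that covers in \<open>kfd_covers X\<close> have a
  member.\<close>

lemma finite_dimensional_subsingleton:
  assumes "topspace Y \<subseteq> {x}"
  shows "finite_dimensional Y"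
proof -
  have "covering_dim_le Y 0"
    unfolding covering_dim_le_def
  proof (intro ballI impI)
    fix \<U> assume U: "\<U> \<in> open_covers Y"
    have "\<exists>\<V> \<in> open_covers Y. finite \<V> \<and> refines \<V> \<U> \<and> \<V> \<subseteq> {topspace Y}"
    proof (cases "topspace Y = {}")
      case True
      then show ?thesis by (intro bexI[of _ "{}"]) (auto simp: open_covers_def refines_def)
    next
      case False
      then have Y: "topspace Y = {x}" using assms by blast
      then have "x \<in> \<Union>\<U>" using U by (simp add: open_covers_def)
      then have "refines {topspace Y} \<U>" by (auto simp: refines_def Y)
      moreover have "{topspace Y} \<in> open_covers Y" by (simp add: open_covers_def)
      ultimately show ?thesis by blast
    qed
    then obtain \<V> where V: "\<V> \<in> open_covers Y" "finite \<V>" "refines \<V> \<U>" "\<V> \<subseteq> {topspace Y}"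
      by blast
    moreover have "card {V \<in> \<V>. y \<in> V} \<le> 0 + 1" for y
    proof -
      have "card {V \<in> \<V>. y \<in> V} \<le> card {topspace Y}" using V(4) by (intro card_mono) auto
      then show ?thesis by simp
    qed
    ultimately show "\<exists>\<V> \<in> open_covers Y. finite \<V> \<and> refines \<V> \<U> \<and>
        (\<forall>y \<in> topspace Y. card {V \<in> \<V>. y \<in> V} \<le> 0 + 1)" by blast
  qed
  then show ?thesis unfolding finite_dimensional_def by blast
qed

section \<open>Compact sets from a winning strategy\<close>

lemma topspace_in_kfd_covers: "{topspace X} \<in> kfd_covers X"
  unfolding kfd_covers_def open_covers_def using compactin_subset_topspace by fastforce

text \<open>
  If no \<open>K\<close> had the property below, a neighbourhood of each \<open>K\<close> that is never TWO's
  response would give a cover to which TWO has no response.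
\<close>
lemma ex_kfd_all_nbhds_responses:
  assumes response: "\<And>C. C \<in> kfd_covers X \<Longrightarrow> \<Phi> C \<in> C"
  shows "\<exists>K. compactin X K \<and> finite_dimensional (subtopology X K) \<and>
    (\<forall>V. openin X V \<and> K \<subseteq> V \<longrightarrow> (\<exists>C \<in> kfd_covers X. \<Phi> C = V))"
proof (rule ccontr)
  assume contra: "\<not> ?thesis"
  define \<C> where "\<C> = {V. openin X V \<and> (\<forall>C \<in> kfd_covers X. \<Phi> C \<noteq> V)}"
  have *: "\<exists>V \<in> \<C>. K \<subseteq> V" if "compactin X K" "finite_dimensional (subtopology X K)" for K
  proof -
    have "\<not> (\<forall>V. openin X V \<and> K \<subseteq> V \<longrightarrow> (\<exists>C \<in> kfd_covers X. \<Phi> C = V))"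
      using contra that by simp
    then show ?thesis by (auto simp: \<C>_def)
  qed
  have "x \<in> \<Union>\<C>" if "x \<in> topspace X" for x
    using *[of "{x}"] finite_dimensional_subsingleton[of "subtopology X {x}" x] that by auto
  then have "\<C> \<in> kfd_covers X"
  proof -
    assume "\<And>x. x \<in> topspace X \<Longrightarrow> x \<in> \<Union>\<C>"
    moreover have "openin X V" if "V \<in> \<C>" for V using that by (simp add: \<C>_def)
    ultimately have "\<C> \<in> open_covers X"
      unfolding open_covers_def using openin_subset[of X] by blast
    then show ?thesis using * by (simp add: kfd_covers_def)
  qed
  with response[OF this] show False by (auto simp: \<C>_def)
qed

text \<open>
  In the proof, \<open>cov U \<gamma>\<close> recovers by recursion a move of ONE to which TWO
  responds with \<open>U \<gamma>\<close>.
\<close>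
lemma G1_kfd_compact_strategy:
  assumes r: "Well_order r" and win: "TWO_wins_G1_kfd X r"
  obtains K where
    "\<And>\<gamma> U. \<gamma> \<in> Field r \<Longrightarrow> compactin X (K \<gamma> U) \<and> finite_dimensional (subtopology X (K \<gamma> U))"
    "\<And>\<gamma> U U'. (\<And>\<beta>. \<beta> \<in> underS r \<gamma> \<Longrightarrow> U \<beta> = U' \<beta>) \<Longrightarrow> K \<gamma> U = K \<gamma> U'"
    "\<And>U. (\<And>\<gamma>. \<gamma> \<in> Field r \<Longrightarrow> openin X (U \<gamma>) \<and> K \<gamma> U \<subseteq> U \<gamma>) \<Longrightarrow> (\<Union>\<gamma>\<in>Field r. U \<gamma>) = topspace X"
proof -
  have wo: "wo_rel r" using r by (simp add: wo_rel_def)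
  note WF = wo_rel.WF[OF wo] and TRANS = wo_rel.TRANS[OF wo] and ANTISYM = wo_rel.ANTISYM[OF wo]
  obtain F where F: "\<And>A. (\<forall>\<gamma> \<in> Field r. A \<gamma> \<in> kfd_covers X) \<Longrightarrow>
      (\<forall>\<gamma> \<in> Field r. F \<gamma> (restrict A (under r \<gamma>)) \<in> A \<gamma>) \<and>
      (\<lambda>\<gamma>. F \<gamma> (restrict A (under r \<gamma>))) ` Field r \<in> open_covers X"
    using win unfolding TWO_wins_G1_kfd_def TWO_wins_def by blast
  define \<Phi> where "\<Phi> \<gamma> c C = F \<gamma> (restrict (c(\<gamma> := C)) (under r \<gamma>))" for \<gamma> c C
  have \<Phi>_cong: "\<Phi> \<gamma> c = \<Phi> \<gamma> c'" if "\<And>\<beta>. \<beta> \<in> underS r \<gamma> \<Longrightarrow> c \<beta> = c' \<beta>" for \<gamma> c c'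
  proof
    fix C
    have "restrict (c(\<gamma> := C)) (under r \<gamma>) = restrict (c'(\<gamma> := C)) (under r \<gamma>)"
      using that by (auto simp: restrict_def under_def underS_def fun_eq_iff)
    then show "\<Phi> \<gamma> c C = \<Phi> \<gamma> c' C" by (simp add: \<Phi>_def)
  qed
  \<comment> \<open>The default \<open>{topspace X}\<close> keeps ONE's moves legal for arbitrary U.
    It is not reached when each \<open>U \<gamma>\<close> is an open neighbourhood of
    \<open>K \<gamma> U\<close>.\<close>
  define H where "H U c \<gamma> = (if \<exists>C \<in> kfd_covers X. \<Phi> \<gamma> c C = U \<gamma>
    then SOME C. C \<in> kfd_covers X \<and> \<Phi> \<gamma> c C = U \<gamma> else {topspace X})" for U c \<gamma>
  define cov where "cov U = wfrec (r - Id) (H U)" for U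
  have cov: "cov U \<gamma> = H U (cov U) \<gamma>" for U \<gamma>
  proof -
    have "\<Phi> \<gamma> (cut (cov U) (r - Id) \<gamma>) = \<Phi> \<gamma> (cov U)"
      by (rule \<Phi>_cong) (auto simp: underS_def cut_apply)
    then show ?thesis unfolding cov_def by (subst wfrec[OF WF]) (simp add: H_def)
  qed
  have H_some: "H U c \<gamma> \<in> kfd_covers X \<and> \<Phi> \<gamma> c (H U c \<gamma>) = U \<gamma>"
    if "\<exists>C \<in> kfd_covers X. \<Phi> \<gamma> c C = U \<gamma>" for U c \<gamma>
  proof -
    have "\<exists>C. C \<in> kfd_covers X \<and> \<Phi> \<gamma> c C = U \<gamma>" using that by blast
    from someI_ex[OF this] show ?thesis using that by (simp add: H_def)
  qed
  have cov_kfd: "cov U \<gamma> \<in> kfd_covers X" for U \<gamma>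
  proof (cases "\<exists>C \<in> kfd_covers X. \<Phi> \<gamma> (cov U) C = U \<gamma>")
    case True
    then show ?thesis using H_some[of \<gamma> "cov U" U] cov[of U \<gamma>] by simp
  next
    case False
    then show ?thesis using cov[of U \<gamma>] topspace_in_kfd_covers by (simp add: H_def)
  qed
  have cov_cong: "cov U \<gamma> = cov U' \<gamma>" if "\<And>\<beta>. \<beta> \<in> insert \<gamma> (underS r \<gamma>) \<Longrightarrow> U \<beta> = U' \<beta>" for U U' \<gamma>
    using that
  proof (induction \<gamma> rule: wf_induct_rule[OF WF])
    case (1 \<gamma>)
    have "\<Phi> \<gamma> (cov U) = \<Phi> \<gamma> (cov U')"
    proof (rule \<Phi>_cong)
      fix \<beta> assume "\<beta> \<in> underS r \<gamma>"
      moreover then have "underS r \<beta> \<subseteq> underS r \<gamma>"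
        using underS_incr[OF TRANS ANTISYM] by (auto simp: underS_def)
      ultimately show "cov U \<beta> = cov U' \<beta>" using 1 by (auto simp: underS_def)
    qed
    then show ?case using 1(2) by (simp add: cov[of _ \<gamma>] H_def)
  qed
  define good where "good \<gamma> U K \<longleftrightarrow> compactin X K \<and> finite_dimensional (subtopology X K) \<and>
    (\<forall>V. openin X V \<and> K \<subseteq> V \<longrightarrow> (\<exists>C \<in> kfd_covers X. \<Phi> \<gamma> (cov U) C = V))" for \<gamma> U K
  define K where "K \<gamma> U = (SOME K. good \<gamma> U K)" for \<gamma> U
  have K: "good \<gamma> U (K \<gamma> U)" if \<gamma>: "\<gamma> \<in> Field r" for \<gamma> U
    unfolding K_def
  proof (rule someI_ex)
    have "\<Phi> \<gamma> (cov U) C \<in> C" if "C \<in> kfd_covers X" for C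
    proof -
      have "\<forall>\<beta> \<in> Field r. ((cov U)(\<gamma> := C)) \<beta> \<in> kfd_covers X" using that cov_kfd by simp
      from F[OF this] have "F \<gamma> (restrict ((cov U)(\<gamma> := C)) (under r \<gamma>)) \<in> ((cov U)(\<gamma> := C)) \<gamma>"
        using \<gamma> by blast
      then show ?thesis by (simp add: \<Phi>_def)
    qed
    from ex_kfd_all_nbhds_responses[of X "\<Phi> \<gamma> (cov U)", OF this] show "\<exists>K. good \<gamma> U K"
      unfolding good_def .
  qed
  show thesis
  proof (rule that[of K])
    show "compactin X (K \<gamma> U) \<and> finite_dimensional (subtopology X (K \<gamma> U))" if "\<gamma> \<in> Field r" for \<gamma> U
      using K[OF that] by (simp add: good_def)
    show "K \<gamma> U = K \<gamma> U'" if eq: "\<And>\<beta>. \<beta> \<in> underS r \<gamma> \<Longrightarrow> U \<beta> = U' \<beta>" for \<gamma> U U'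
    proof -
      have "\<Phi> \<gamma> (cov U) = \<Phi> \<gamma> (cov U')"
      proof (rule \<Phi>_cong, rule cov_cong)
        fix \<beta> \<beta>' assume "\<beta> \<in> underS r \<gamma>" "\<beta>' \<in> insert \<beta> (underS r \<beta>)"
        moreover then have "underS r \<beta> \<subseteq> underS r \<gamma>"
          using underS_incr[OF TRANS ANTISYM] by (auto simp: underS_def)
        ultimately show "U \<beta>' = U' \<beta>'" using eq by blast
      qed
      \<comment> \<open>U enters \<open>good\<close> only through
        \<open>\<Phi> \<gamma> (cov U)\<close>, so the predicates coincide and \<open>SOME\<close>
        selects the same set.\<close>
      then show ?thesis by (simp add: K_def good_def)
    qed
    show "(\<Union>\<gamma>\<in>Field r. U \<gamma>) = topspace X"
      if U: "\<And>\<gamma>. \<gamma> \<in> Field r \<Longrightarrow> openin X (U \<gamma>) \<and> K \<gamma> U \<subseteq> U \<gamma>" for U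
    proof -
      \<comment> \<open>Against the play \<open>cov U\<close> the strategy answers exactly with U,
        so its victory says that U covers X.\<close>
      have "F \<gamma> (restrict (cov U) (under r \<gamma>)) = U \<gamma>" if \<gamma>: "\<gamma> \<in> Field r" for \<gamma>
      proof -
        have "\<exists>C \<in> kfd_covers X. \<Phi> \<gamma> (cov U) C = U \<gamma>"
          using K[OF \<gamma>, of U] U[OF \<gamma>] by (simp add: good_def)
        from H_some[of \<gamma> "cov U" U, OF this] have "\<Phi> \<gamma> (cov U) (cov U \<gamma>) = U \<gamma>" using cov[of U \<gamma>] by simp
        then show ?thesis by (simp add: \<Phi>_def)
      qed
      then have "(\<lambda>\<gamma>. F \<gamma> (restrict (cov U) (under r \<gamma>))) ` Field r = U ` Field r"
        by (rule image_cong[OF refl])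
      then have "U ` Field r \<in> open_covers X" using F[of "cov U"] cov_kfd by simp
      then show ?thesis by (simp add: open_covers_def)
    qed
  qed
qed

section \<open>Simulation of one game in the other\<close>

text \<open>
  The state of TWO in inning \<open>\<gamma>\<close> is a triple \<open>(g, j, B)\<close>: TWO simulates inning \<open>g\<close> of
  the strategy \<open>n, Z\<close>, responds with \<open>B\<close> and thereby covers \<open>Z g U j\<close>. After
  finitely many innings the simulation proceeds to the successor of \<open>g\<close>; at a limit \<open>\<gamma>\<close>
  it proceeds to \<open>g = \<gamma>\<close>.
\<close>
lemma TWO_wins_Gc_limit:
  fixes n :: "'i \<Rightarrow> ('i \<Rightarrow> 'a set) \<Rightarrow> nat" and Z :: "'i \<Rightarrow> ('i \<Rightarrow> 'a set) \<Rightarrow> nat \<Rightarrow> 'a set"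
  assumes r: "Well_order r"
    and limit: "\<And>i. i \<in> Field r \<Longrightarrow> \<exists>j \<in> Field r. j \<noteq> i \<and> (i, j) \<in> r"
    and thin: "\<And>\<gamma> U j. \<gamma> \<in> Field r \<Longrightarrow> thin_in X (Z \<gamma> U j)"
    and cong: "\<And>\<gamma> U U'. (\<And>\<beta>. \<beta> \<in> underS r \<gamma> \<Longrightarrow> U \<beta> = U' \<beta>) \<Longrightarrow> n \<gamma> U = n \<gamma> U' \<and> Z \<gamma> U = Z \<gamma> U'"
    and win: "\<And>U. (\<And>\<gamma>. \<gamma> \<in> Field r \<Longrightarrow> openin X (U \<gamma>) \<and> (\<Union>j\<le>n \<gamma> U. Z \<gamma> U j) \<subseteq> U \<gamma>) \<Longrightarrow>
      (\<Union>\<gamma>\<in>Field r. U \<gamma>) = topspace X"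
  shows "TWO_wins_Gc X r"
proof -
  have wo: "wo_rel r" using r by (simp add: wo_rel_def)
  note WF = wo_rel.WF[OF wo] and TOTALS = wo_rel.TOTALS[OF wo]
  have r_trans: "(x, z) \<in> r" if "(x, y) \<in> r" "(y, z) \<in> r" for x y z
    using wo_rel.TRANS[OF wo] that by (rule transD)
  have r_antisym: "x = y" if "(x, y) \<in> r" "(y, x) \<in> r" for x y
    using wo_rel.ANTISYM[OF wo] that by (rule antisymD)
  have r_refl: "(x, x) \<in> r" if "x \<in> Field r" for x
    using wo_rel.REFL[OF wo] that by (simp add: refl_on_def)
  define sc where "sc i = wo_rel.suc r {i}" for i
  have above: "AboveS r {i} \<noteq> {}" if "i \<in> Field r" for i
    using limit[OF that] by (auto simp: AboveS_def)
  have sc: "sc i \<in> Field r" "i \<noteq> sc i" "(i, sc i) \<in> r" if "i \<in> Field r" for i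
    using wo_rel.suc_greater[OF wo, of "{i}" i] wo_rel.suc_inField[OF wo, of "{i}"] above[OF that] that
    by (auto simp: sc_def)
  have sc_least: "(sc i, j) \<in> r" if "(i, j) \<in> r" "i \<noteq> j" for i j
    unfolding sc_def
    by (rule wo_rel.suc_least_AboveS[OF wo]) (use that in \<open>auto simp: AboveS_def Field_def\<close>)
  have less_sc: "(i, j) \<in> r" if "(i, sc j) \<in> r" "i \<noteq> sc j" "j \<in> Field r" for i j
    using that sc_least[of j i] sc[of j] TOTALS r_antisym r_refl by (metis FieldI1)
  have sc_inj: "i = j" if "sc i = sc j" "i \<in> Field r" "j \<in> Field r" for i j
    using that less_sc sc r_antisym by metis
  define D where "D Y \<A> = (SOME \<B>. pairwise disjnt \<B> \<and> refines \<B> \<A> \<and> (\<forall>B \<in> \<B>. openin X B) \<and> Y \<subseteq> \<Union>\<B>)"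
    for Y and \<A> :: "'a set set"
  have D: "pairwise disjnt (D Y \<A>) \<and> refines (D Y \<A>) \<A> \<and> (\<forall>B \<in> D Y \<A>. openin X B) \<and> Y \<subseteq> \<Union>(D Y \<A>)"
    if "thin_in X Y" "\<A> \<in> open_covers X" for Y \<A>
    unfolding D_def by (rule someI_ex) (use that in \<open>auto simp: thin_in_def\<close>)
  define hist where "hist s \<gamma> g = (\<Union>\<beta>\<in>{\<beta> \<in> underS r \<gamma>. fst (s \<beta>) = g}. \<Union>(snd (snd (s \<beta>))))"
    for s :: "'i \<Rightarrow> 'i \<times> nat \<times> 'a set set" and \<gamma> g
  define pos where "pos s \<gamma> = (if \<exists>p \<in> Field r. \<gamma> = sc p
      then let p = (THE p. p \<in> Field r \<and> \<gamma> = sc p); g = fst (s p); j = fst (snd (s p))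
        in if j < n g (hist s \<gamma>) then (g, Suc j) else (sc g, 0)
      else (\<gamma>, 0))" for s :: "'i \<Rightarrow> 'i \<times> nat \<times> 'a set set" and \<gamma>
  have pos_sc: "pos s (sc p) = (if fst (snd (s p)) < n (fst (s p)) (hist s (sc p))
      then (fst (s p), Suc (fst (snd (s p)))) else (sc (fst (s p)), 0))" if "p \<in> Field r" for s p
  proof -
    have "(THE p'. p' \<in> Field r \<and> sc p = sc p') = p"
    proof (rule the_equality)
      show "p \<in> Field r \<and> sc p = sc p" using that by simp
      show "p' = p" if "p' \<in> Field r \<and> sc p = sc p'" for p'
        using sc_inj[of p' p] that \<open>p \<in> Field r\<close> by simp
    qed
    then show ?thesis using that by (auto simp: pos_def Let_def)
  qed
  have pos_lim: "pos s \<gamma> = (\<gamma>, 0)" if "\<And>p. p \<in> Field r \<Longrightarrow> \<gamma> \<noteq> sc p" for s \<gamma>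
    using that by (auto simp: pos_def)
  define H where "H A s \<gamma> = (let (g, j) = pos s \<gamma> in (g, j, D (Z g (hist s \<gamma>) j) (A \<gamma>)))"
    for A :: "'i \<Rightarrow> 'a set set" and s \<gamma>
  have hist_cut: "hist (cut s (r - Id) \<gamma>) \<gamma> = hist s \<gamma>" for s \<gamma>
    by (auto simp: hist_def underS_def cut_def fun_eq_iff)
  have pos_cut: "pos (cut s (r - Id) \<gamma>) \<gamma> = pos s \<gamma>" for s \<gamma>
  proof (cases "\<exists>p \<in> Field r. \<gamma> = sc p")
    case True
    then obtain p where p: "p \<in> Field r" "\<gamma> = sc p" by blast
    then have "cut s (r - Id) (sc p) p = s p" using sc by (simp add: cut_def)
    then show ?thesis using hist_cut[of s "sc p"] by (simp add: p pos_sc)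
  next
    case False
    then show ?thesis by (simp add: pos_lim)
  qed
  define S where "S A = wfrec (r - Id) (H A)" for A
  have S: "S A \<gamma> = H A (S A) \<gamma>" for A \<gamma>
    unfolding S_def by (subst wfrec[OF WF]) (simp add: H_def hist_cut pos_cut)
  have S_cong: "S A \<gamma> = S A' \<gamma>" if "\<And>\<beta>. \<beta> \<in> insert \<gamma> (underS r \<gamma>) \<Longrightarrow> A \<beta> = A' \<beta>" for A A' \<gamma>
    using that
  proof (induction \<gamma> rule: wf_induct_rule[OF WF])
    case (1 \<gamma>)
    have eq: "cut (S A) (r - Id) \<gamma> = cut (S A') (r - Id) \<gamma>"
    proof -
      have "S A \<beta> = S A' \<beta>" if \<beta>: "(\<beta>, \<gamma>) \<in> r - Id" for \<beta>
      proof (rule 1(1)[OF \<beta>])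
        fix \<beta>' assume "\<beta>' \<in> insert \<beta> (underS r \<beta>)"
        then have "(\<beta>', \<gamma>) \<in> r" "\<beta>' \<noteq> \<gamma>"
          using \<beta> r_trans r_antisym by (auto simp: underS_def)
        then show "A \<beta>' = A' \<beta>'" using 1(2) by (simp add: underS_def)
      qed
      then show ?thesis by (auto simp: cut_def)
    qed
    have "H A (S A) \<gamma> = H A' (S A') \<gamma>"
      using hist_cut[of "S A" \<gamma>] hist_cut[of "S A'" \<gamma>] pos_cut[of "S A" \<gamma>] pos_cut[of "S A'" \<gamma>]
        1(2)[of \<gamma>] unfolding H_def eq by simp
    then show ?case using S by simp
  qed
  \<comment> \<open>The recursion is rerun on the truncated history. By \<open>S_cong\<close> the
    state at \<gamma> reads no later covers, so this agrees with the run on the full play.\<close>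
  define F where "F \<gamma> h = snd (snd (S h \<gamma>))" for \<gamma> h
  have "(\<forall>\<gamma> \<in> Field r. pairwise disjnt (F \<gamma> (restrict A (under r \<gamma>))) \<and>
        refines (F \<gamma> (restrict A (under r \<gamma>))) (A \<gamma>)) \<and>
      \<Union>((\<lambda>\<gamma>. F \<gamma> (restrict A (under r \<gamma>))) ` Field r) \<in> open_covers X"
    if A: "\<forall>\<gamma> \<in> Field r. A \<gamma> \<in> open_covers X" for A
  proof -
    define G where "G \<gamma> = fst (S A \<gamma>)" for \<gamma>
    define J where "J \<gamma> = fst (snd (S A \<gamma>))" for \<gamma>
    define B where "B \<gamma> = snd (snd (S A \<gamma>))" for \<gamma>
    define U where "U g = (\<Union>\<gamma>\<in>{\<gamma> \<in> Field r. G \<gamma> = g}. \<Union>(B \<gamma>))" for g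
    let ?h = "hist (S A)"
    have FB: "F \<gamma> (restrict A (under r \<gamma>)) = B \<gamma>" if "\<gamma> \<in> Field r" for \<gamma>
      unfolding F_def B_def
      by (subst S_cong[of \<gamma> _ A]) (use that r_refl in \<open>auto simp: underS_def under_def\<close>)
    have GJ: "(G \<gamma>, J \<gamma>) = pos (S A) \<gamma>" and B: "B \<gamma> = D (Z (G \<gamma>) (?h \<gamma>) (J \<gamma>)) (A \<gamma>)" for \<gamma>
      using S[of A \<gamma>] by (auto simp: G_def J_def B_def H_def split: prod.splits)
    have GJ_sc: "(G (sc p), J (sc p)) =
        (if J p < n (G p) (?h (sc p)) then (G p, Suc (J p)) else (sc (G p), 0))" if "p \<in> Field r" for p
      unfolding GJ pos_sc[OF that] by (simp add: G_def J_def)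
    have G_lim: "G \<gamma> = \<gamma>" "J \<gamma> = 0" if "\<And>p. p \<in> Field r \<Longrightarrow> \<gamma> \<noteq> sc p" for \<gamma>
      using GJ[of \<gamma>] pos_lim[OF that] by auto
    have G_sc: "(G p, G (sc p)) \<in> r" if "p \<in> Field r" "G p \<in> Field r" for p
      using GJ_sc[OF that(1)] that(2) r_refl sc by (auto split: if_splits)
    \<comment> \<open>The simulation never runs ahead of the actual inning; hence the jump to g =
      \<gamma> at a limit \<gamma> does not go backwards.\<close>
    have G_le: "(G \<gamma>, \<gamma>) \<in> r" if "\<gamma> \<in> Field r" for \<gamma>
      using that
    proof (induction \<gamma> rule: wf_induct_rule[OF WF])
      case (1 \<gamma>)
      show ?case
      proof (cases "\<exists>p \<in> Field r. \<gamma> = sc p")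
        case True
        then obtain p where p: "p \<in> Field r" "\<gamma> = sc p" by blast
        then have IH: "(G p, p) \<in> r" using 1(1)[of p] sc by auto
        have le: "(G p, sc p) \<in> r" using r_trans[OF IH sc(3)[OF p(1)]] .
        have "G p \<noteq> sc p" using r_antisym[of "sc p" p] IH sc[OF p(1)] by auto
        then have "(sc (G p), sc p) \<in> r" using sc_least[OF le] by simp
        then show ?thesis using GJ_sc[OF p(1)] le by (simp add: p(2) split: if_splits)
      next
        case False
        then have "G \<gamma> = \<gamma>" using G_lim by blast
        then show ?thesis using 1(2) r_refl by simp
      qed
    qed
    have G_Field: "G \<gamma> \<in> Field r" if "\<gamma> \<in> Field r" for \<gamma>
      using G_le[OF that] by (rule FieldI1)
    have G_mono: "(G \<beta>, G \<gamma>) \<in> r" if "(\<beta>, \<gamma>) \<in> r" for \<beta> \<gamma>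
      using that
    proof (induction \<gamma> rule: wf_induct_rule[OF WF])
      case (1 \<gamma>)
      then have F: "\<beta> \<in> Field r" "\<gamma> \<in> Field r" by (auto intro: FieldI1 FieldI2)
      show ?case
      proof (cases "\<beta> = \<gamma>")
        case True
        then show ?thesis using G_Field[OF F(1)] r_refl by simp
      next
        case neq: False
        show ?thesis
        proof (cases "\<exists>p \<in> Field r. \<gamma> = sc p")
          case True
          then obtain p where p: "p \<in> Field r" "\<gamma> = sc p" by blast
          have "(\<beta>, p) \<in> r" using less_sc[of \<beta> p] p neq 1(2) by simp
          then have "(G \<beta>, G p) \<in> r" using 1(1)[of p] p sc by simp
          then show ?thesis using G_sc[OF p(1) G_Field[OF p(1)]] r_trans p(2) by blast
        next
          case False
          then have "G \<gamma> = \<gamma>" using G_lim by blast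
          then show ?thesis using G_le[OF F(1)] 1(2) r_trans by metis
        qed
      qed
    qed
    \<comment> \<open>As G is monotone, no inning from \<gamma> on returns to a g below
      \<open>G \<gamma>\<close>: the set gathered for g is final. By \<open>cong\<close>, TWO thus
      computes the correct n and Z.\<close>
    have hist: "?h \<gamma> g = U g" if \<gamma>: "\<gamma> \<in> Field r" and g: "g \<in> underS r (G \<gamma>)" for \<gamma> g
    proof -
      have "\<beta> \<in> underS r \<gamma>" if "\<beta> \<in> Field r" "G \<beta> = g" for \<beta>
      proof (rule ccontr)
        assume "\<beta> \<notin> underS r \<gamma>"
        then have "(\<gamma>, \<beta>) \<in> r" using that(1) \<gamma> TOTALS r_refl by (auto simp: underS_def)
        then have "(G \<gamma>, g) \<in> r" using G_mono that(2) by blast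
        then show False using g r_antisym[of g "G \<gamma>"] by (simp add: underS_def)
      qed
      then have "{\<beta> \<in> underS r \<gamma>. G \<beta> = g} = {\<beta> \<in> Field r. G \<beta> = g}"
        by (auto simp: underS_def intro: FieldI1)
      then show ?thesis by (simp add: hist_def U_def G_def B_def)
    qed
    have nZ: "n (G \<gamma>) (?h \<gamma>) = n (G \<gamma>) U" "Z (G \<gamma>) (?h \<gamma>) = Z (G \<gamma>) U" if "\<gamma> \<in> Field r" for \<gamma>
      using cong[of "G \<gamma>" "?h \<gamma>" U] hist[OF that] by auto
    have n_sc: "n (G p) (?h (sc p)) = n (G p) U" if p: "p \<in> Field r" for p
    proof -
      have "g \<in> underS r (G (sc p))" if "g \<in> underS r (G p)" for g
        using that G_sc[OF p G_Field[OF p]] r_trans[of g "G p" "G (sc p)"] r_antisym[of g "G p"]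
        by (auto simp: underS_def)
      then show ?thesis using cong[of "G p" "?h (sc p)" U] hist[OF sc(1)[OF p]] by auto
    qed
    have advance: "\<exists>\<gamma> \<in> Field r. G \<gamma> = g \<and> J \<gamma> = j"
      if "\<gamma>0 \<in> Field r" "G \<gamma>0 = g" "J \<gamma>0 = 0" "j \<le> n g U" for \<gamma>0 g j
      using that(4)
    proof (induction j)
      case 0
      then show ?case using that by blast
    next
      case (Suc j)
      then obtain \<gamma> where "\<gamma> \<in> Field r" "G \<gamma> = g" "J \<gamma> = j" by auto
      then show ?case using GJ_sc[of \<gamma>] n_sc[of \<gamma>] Suc.prems sc(1)[of \<gamma>]
        by (intro bexI[of _ "sc \<gamma>"]) auto
    qed
    \<comment> \<open>A successor g begins right after the finite run of its predecessor, and these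
      runs use successor innings only, which exist because r has no last element. Any other g begins
      in inning g itself.\<close>
    have start: "\<exists>\<gamma> \<in> Field r. G \<gamma> = g \<and> J \<gamma> = 0" if "g \<in> Field r" for g
      using that
    proof (induction g rule: wf_induct_rule[OF WF])
      case (1 g)
      show ?case
      proof (cases "\<exists>p \<in> Field r. g = sc p")
        case True
        then obtain p where p: "p \<in> Field r" "g = sc p" by blast
        then obtain \<gamma>0 where "\<gamma>0 \<in> Field r" "G \<gamma>0 = p" "J \<gamma>0 = 0" using 1(1)[of p] sc by auto
        then obtain \<gamma> where "\<gamma> \<in> Field r" "G \<gamma> = p" "J \<gamma> = n p U" using advance by blast
        then show ?thesis using GJ_sc[of \<gamma>] n_sc[of \<gamma>] sc(1)[of \<gamma>] p(2)
          by (intro bexI[of _ "sc \<gamma>"]) auto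
      next
        case False
        then show ?thesis using G_lim[of g] 1(2) by blast
      qed
    qed
    have BD: "pairwise disjnt (B \<gamma>) \<and> refines (B \<gamma>) (A \<gamma>) \<and> (\<forall>W \<in> B \<gamma>. openin X W) \<and>
        Z (G \<gamma>) U (J \<gamma>) \<subseteq> \<Union>(B \<gamma>)" if "\<gamma> \<in> Field r" for \<gamma>
      unfolding B nZ(2)[OF that] by (rule D) (use that A thin G_Field in auto)
    have "(\<Union>g\<in>Field r. U g) = topspace X"
    proof (rule win, intro conjI)
      fix g assume g: "g \<in> Field r"
      show "openin X (U g)" unfolding U_def using BD by (intro openin_Union) auto
      show "(\<Union>j\<le>n g U. Z g U j) \<subseteq> U g"
      proof (rule UN_least)
        fix j assume "j \<in> {..n g U}"
        moreover obtain \<gamma>0 where "\<gamma>0 \<in> Field r" "G \<gamma>0 = g" "J \<gamma>0 = 0" using start[OF g] by blast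
        ultimately obtain \<gamma> where "\<gamma> \<in> Field r" "G \<gamma> = g" "J \<gamma> = j"
          using advance[of \<gamma>0 g j] by auto
        then show "Z g U j \<subseteq> U g" using BD[of \<gamma>] by (auto simp: U_def)
      qed
    qed
    moreover have "(\<Union>g\<in>Field r. U g) = \<Union>(\<Union>(B ` Field r))"
      using G_Field by (auto simp: U_def)
    moreover have "openin X W" if "W \<in> \<Union>(B ` Field r)" for W using BD that by blast
    ultimately have "\<Union>(B ` Field r) \<in> open_covers X" by (simp add: open_covers_def)
    moreover have "(\<lambda>\<gamma>. F \<gamma> (restrict A (under r \<gamma>))) ` Field r = B ` Field r"
      by (rule image_cong[OF refl FB])
    ultimately show ?thesis using FB BD by simp
  qed
  then show ?thesis unfolding TWO_wins_Gc_def TWO_wins_def by blast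
qed

lemma (in Metric_space) TWO_wins_Gc_if_G1_kfd:
  assumes r: "Well_order r" and limit: "\<And>i. i \<in> Field r \<Longrightarrow> \<exists>j \<in> Field r. j \<noteq> i \<and> (i, j) \<in> r"
    and win: "TWO_wins_G1_kfd mtopology r"
  shows "TWO_wins_Gc mtopology r"
proof -
  have "\<forall>T. \<exists>(n :: nat) Z. compactin mtopology T \<and> finite_dimensional (subtopology mtopology T) \<longrightarrow>
      T \<subseteq> (\<Union>j\<le>n. Z j) \<and> (\<forall>j. thin_in mtopology (Z j))"
    using compact_fd_thin_decomposition by metis
  \<comment> \<open>The decomposition is chosen once for each compact set, so equal sets K give
    equal n and Z, as the congruence condition of the simulation demands.\<close>
  then obtain n :: "'a set \<Rightarrow> nat" and Z where nZ:
    "\<And>T. compactin mtopology T \<and> finite_dimensional (subtopology mtopology T) \<Longrightarrow>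
      T \<subseteq> (\<Union>j\<le>n T. Z T j) \<and> (\<forall>j. thin_in mtopology (Z T j))"
    by metis
  show ?thesis
  proof (rule G1_kfd_compact_strategy[OF r win])
    fix K
    assume K: "\<And>\<gamma> U. \<gamma> \<in> Field r \<Longrightarrow>
        compactin mtopology (K \<gamma> U) \<and> finite_dimensional (subtopology mtopology (K \<gamma> U))"
      and K_cong: "\<And>\<gamma> U U'. (\<And>\<beta>. \<beta> \<in> underS r \<gamma> \<Longrightarrow> U \<beta> = U' \<beta>) \<Longrightarrow> K \<gamma> U = K \<gamma> U'"
      and K_win: "\<And>U. (\<And>\<gamma>. \<gamma> \<in> Field r \<Longrightarrow> openin mtopology (U \<gamma>) \<and> K \<gamma> U \<subseteq> U \<gamma>) \<Longrightarrow>
        (\<Union>\<gamma>\<in>Field r. U \<gamma>) = topspace mtopology"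
    show ?thesis
    proof (rule TWO_wins_Gc_limit[OF r limit, of _ "\<lambda>\<gamma> U. Z (K \<gamma> U)" "\<lambda>\<gamma> U. n (K \<gamma> U)"])
      show "thin_in mtopology (Z (K \<gamma> U) j)" if "\<gamma> \<in> Field r" for \<gamma> U j
        using nZ[OF K[OF that]] by blast
      show "n (K \<gamma> U) = n (K \<gamma> U') \<and> Z (K \<gamma> U) = Z (K \<gamma> U')"
        if "\<And>\<beta>. \<beta> \<in> underS r \<gamma> \<Longrightarrow> U \<beta> = U' \<beta>" for \<gamma> U U'
        using K_cong[OF that] by simp
      show "(\<Union>\<gamma>\<in>Field r. U \<gamma>) = topspace mtopology"
        if U: "\<And>\<gamma>. \<gamma> \<in> Field r \<Longrightarrow> openin mtopology (U \<gamma>) \<and>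
          (\<Union>j\<le>n (K \<gamma> U). Z (K \<gamma> U) j) \<subseteq> U \<gamma>" for U
      proof (rule K_win)
        show "openin mtopology (U \<gamma>) \<and> K \<gamma> U \<subseteq> U \<gamma>" if "\<gamma> \<in> Field r" for \<gamma>
          using U[OF that] nZ[OF K[OF that]] by (meson subset_trans)
      qed
    qed
  qed
qed

section \<open>Longer and isomorphic lengths\<close>

text \<open>On the initial segment that is the image of r, TWO copies the given strategy; an
  embedding maps \<open>under r a\<close> into \<open>under s (f a)\<close>, so all moves it
  consults are visible. Elsewhere any legal move will do.\<close>

lemma TWO_wins_G1_kfd_mono:
  assumes le: "r \<le>o s" and win: "TWO_wins_G1_kfd X r"
  shows "TWO_wins_G1_kfd X s"
proof -
  obtain f where r: "Well_order r" and s: "Well_order s" and f: "embed r s f"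
    using le by (auto simp: ordLeq_def)
  define g where "g = inv_into (Field r) f"
  have gf: "g (f a) = a" if "a \<in> Field r" for a
    using embed_inj_on[OF r f] that by (simp add: g_def inv_into_f_f)
  have f_Field: "f a \<in> Field s" if "a \<in> Field r" for a using embed_in_Field[OF f that] .
  obtain F where F: "\<And>A. (\<forall>\<gamma> \<in> Field r. A \<gamma> \<in> kfd_covers X) \<Longrightarrow>
      (\<forall>\<gamma> \<in> Field r. F \<gamma> (restrict A (under r \<gamma>)) \<in> A \<gamma>) \<and>
      (\<lambda>\<gamma>. F \<gamma> (restrict A (under r \<gamma>))) ` Field r \<in> open_covers X"
    using win unfolding TWO_wins_G1_kfd_def TWO_wins_def by blast
  define F' where "F' \<gamma> h = (if \<gamma> \<in> f ` Field r
      then F (g \<gamma>) (restrict (h \<circ> f) (under r (g \<gamma>))) else SOME U. U \<in> h \<gamma>)"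
    for \<gamma> and h :: "'b \<Rightarrow> 'c set set"
  have "(\<forall>\<gamma> \<in> Field s. F' \<gamma> (restrict A (under s \<gamma>)) \<in> A \<gamma>) \<and>
      (\<lambda>\<gamma>. F' \<gamma> (restrict A (under s \<gamma>))) ` Field s \<in> open_covers X"
    if A: "\<forall>\<gamma> \<in> Field s. A \<gamma> \<in> kfd_covers X" for A
  proof -
    let ?R' = "\<lambda>\<gamma>. F' \<gamma> (restrict A (under s \<gamma>))" and ?R = "\<lambda>a. F a (restrict (A \<circ> f) (under r a))"
    have R: "?R a \<in> A (f a)" if "a \<in> Field r" for a
      using F[of "A \<circ> f"] A f_Field that by simp
    have cov: "?R ` Field r \<in> open_covers X" using F[of "A \<circ> f"] A f_Field by simp
    have eq: "?R' (f a) = ?R a" if a: "a \<in> Field r" for a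
    proof -
      have "f b \<in> under s (f a)" if "b \<in> under r a" for b
        using f a that by (auto simp: embed_def bij_betw_def)
      then have "restrict (restrict A (under s (f a)) \<circ> f) (under r a) = restrict (A \<circ> f) (under r a)"
        by (auto simp: restrict_def fun_eq_iff)
      then show ?thesis using a by (simp add: F'_def gf)
    qed
    have legal: "?R' \<gamma> \<in> A \<gamma>" if \<gamma>: "\<gamma> \<in> Field s" for \<gamma>
    proof (cases "\<gamma> \<in> f ` Field r")
      case True
      then show ?thesis using eq R by auto
    next
      case False
      \<comment> \<open>The empty compact set forces every cover of ONE to have a member, so the
        arbitrary moves exist even when X is empty.\<close>
      have "compactin X {} \<and> finite_dimensional (subtopology X {})"
        using finite_dimensional_subsingleton[of "subtopology X {}"] by simp
      then have "\<exists>U. U \<in> A \<gamma>" using A \<gamma> unfolding kfd_covers_def by blast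
      then have "(SOME U. U \<in> A \<gamma>) \<in> A \<gamma>" by (rule someI_ex)
      moreover have "\<gamma> \<in> under s \<gamma>"
        using s \<gamma> by (auto simp: under_def order_on_defs refl_on_def)
      ultimately show ?thesis using False by (simp add: F'_def)
    qed
    have op: "openin X (?R' \<gamma>)" if "\<gamma> \<in> Field s" for \<gamma>
      using legal[OF that] A that unfolding kfd_covers_def open_covers_def by blast
    have "?R ` Field r \<subseteq> ?R' ` Field s"
    proof (rule image_subsetI)
      fix a assume a: "a \<in> Field r"
      show "?R a \<in> ?R' ` Field s" unfolding eq[OF a, symmetric] by (rule imageI[OF f_Field[OF a]])
    qed
    from Union_mono[OF this] have "topspace X \<subseteq> \<Union>(?R' ` Field s)"
      using cov by (simp add: open_covers_def)
    moreover have "\<Union>(?R' ` Field s) \<subseteq> topspace X"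
      by (rule UN_least) (rule openin_subset[OF op])
    ultimately have "?R' ` Field s \<in> open_covers X" using op by (simp add: open_covers_def)
    then show ?thesis using legal by simp
  qed
  then show ?thesis unfolding TWO_wins_G1_kfd_def TWO_wins_def by blast
qed

section \<open>Comparison of ordinals\<close>

lemma ordLeq_ord_sum_left:
  assumes r: "Well_order r" and s: "Well_order s"
  shows "r \<le>o r +\<^sub>o s"
proof -
  have "bij_betw Inl (under r a) (under (r +\<^sub>o s) (Inl a))" for a
  proof -
    have "under (r +\<^sub>o s) (Inl a) = Inl ` under r a"
    proof (rule set_eqI)
      fix x show "x \<in> under (r +\<^sub>o s) (Inl a) \<longleftrightarrow> x \<in> Inl ` under r a"
        by (cases x) (auto simp: under_def)
    qed
    then show ?thesis by (simp add: bij_betw_def)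
  qed
  then show ?thesis
    unfolding ordLeq_def embed_def using r Well_order_ord_sum[OF r s] by blast
qed

text \<open>\<open>Inr\<close> does not map onto an initial segment, so it is not an embedding. If
  the sum were shorter than s, however, \<open>Inr\<close> would yield an order-preserving injection
  of s into the part below some a, whereas such maps never move a point down.\<close>

lemma ordLeq_ord_sum_right:
  assumes r: "Well_order r" and s: "Well_order s"
  shows "s \<le>o r +\<^sub>o s"
proof (rule ccontr)
  assume "\<not> s \<le>o r +\<^sub>o s"
  then have "r +\<^sub>o s <o s"
    using not_ordLeq_iff_ordLess[OF Well_order_ord_sum[OF r s] s] by blast
  then obtain a where a: "a \<in> Field s" "r +\<^sub>o s =o Restr s (underS s a)"
    using ordLess_iff_ordIso_Restr[OF s Well_order_ord_sum[OF r s]] by blast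
  then obtain f where f: "iso (r +\<^sub>o s) (Restr s (underS s a)) f" by (auto simp: ordIso_def)
  have wo: "wo_rel s" using s by (simp add: wo_rel_def)
  define h where "h = f \<circ> Inr"
  have h_mono: "(h x, h y) \<in> s" "h x \<in> underS s a" if "(x, y) \<in> s" for x y
    using iso_forward[OF _ f, of "Inr x" "Inr y"] that by (simp_all add: h_def)
  have "inj_on f (Field (r +\<^sub>o s))" using f by (simp add: iso_iff2 bij_betw_def)
  then have h_inj: "x = y" if "h x = h y" "x \<in> Field s" "y \<in> Field s" for x y
    using that by (auto simp: h_def inj_on_def Field_ord_sum)
  \<comment> \<open>If h x < x, induction gives h x \<le> h (h x) and monotonicity gives the
    converse, so h x is a fixed point and injectivity fails.\<close>
  have expand: "(x, h x) \<in> s" if "x \<in> Field s" for x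
    using that
  proof (induction x rule: wf_induct_rule[OF wo_rel.WF[OF wo]])
    case (1 x)
    have xx: "(x, x) \<in> s" using wo_rel.REFL[OF wo] 1(2) by (simp add: refl_on_def)
    have hx: "h x \<in> Field s" using h_mono(1)[OF xx] by (rule FieldI1)
    show ?case
    proof (rule ccontr)
      assume "(x, h x) \<notin> s"
      then have less: "(h x, x) \<in> s" "h x \<noteq> x"
        using wo_rel.TOTALS[OF wo] 1(2) hx xx by auto
      then have "(h x, h (h x)) \<in> s" using 1(1) hx by blast
      moreover have "(h (h x), h x) \<in> s" using h_mono(1)[OF less(1)] .
      ultimately have "h (h x) = h x" using antisymD[OF wo_rel.ANTISYM[OF wo]] by blast
      then show False using h_inj hx 1(2) less(2) by blast
    qed
  qed
  have aa: "(a, a) \<in> s" using wo_rel.REFL[OF wo] a(1) by (simp add: refl_on_def)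
  have "(h a, a) \<in> s" "h a \<noteq> a" using h_mono(2)[OF aa] by (auto simp: underS_def)
  then show False using expand[OF a(1)] antisymD[OF wo_rel.ANTISYM[OF wo]] by blast
qed

lemma limit_ordinal_ord_sum_natLeq:
  assumes "Well_order r"
  shows "limit_ordinal (r +\<^sub>o natLeq)"
proof -
  have "\<exists>j \<in> Field (r +\<^sub>o natLeq). j \<noteq> i \<and> (i, j) \<in> r +\<^sub>o natLeq"
    if "i \<in> Field (r +\<^sub>o natLeq)" for i
  proof (cases i)
    case (Inl a)
    then show ?thesis using that
      by (intro bexI[of _ "Inr 0"]) (auto simp: Field_ord_sum Field_natLeq)
  next
    case (Inr k)
    have "(k, Suc k) \<in> natLeq" by (simp add: natLeq_def)
    then show ?thesis using Inr
      by (intro bexI[of _ "Inr (Suc k)"]) (auto simp: Field_ord_sum Field_natLeq)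
  qed
  moreover have "(Inr 0, Inr 0) \<in> r +\<^sub>o natLeq" by (simp add: natLeq_def)
  then have "r +\<^sub>o natLeq \<noteq> {}" by blast
  ultimately show ?thesis
    unfolding limit_ordinal_def using Well_order_ord_sum[OF assms natLeq_Well_order] by blast
qed

lemma limit_ordinal_ordIso:
  fixes r :: "'i rel" and s :: "'j rel"
  assumes "r =o s" "limit_ordinal r"
  shows "limit_ordinal s"
proof -
  obtain f where s: "Well_order s" and f: "iso r s f" using assms(1) by (auto simp: ordIso_def)
  then have bij: "f ` Field r = Field s" and inj: "inj_on f (Field r)"
    by (auto simp: iso_iff2 bij_betw_def)
  have "\<exists>j \<in> Field s. j \<noteq> f i \<and> (f i, j) \<in> s" if i: "i \<in> Field r" for i
  proof -
    obtain j where "j \<in> Field r" "j \<noteq> i" "(i, j) \<in> r"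
      using assms(2) i unfolding limit_ordinal_def by blast
    then show ?thesis
      using iso_forward[OF _ f] inj i bij by (intro bexI[of _ "f j"]) (auto dest: inj_onD)
  qed
  moreover have "Field r \<noteq> {}" using assms(2) by (auto simp: limit_ordinal_def Field_def)
  then have "s \<noteq> {}" using bij by auto
  ultimately show ?thesis using s unfolding limit_ordinal_def bij[symmetric] by blast
qed

text \<open>
  \<^term>\<open>tp_Sc\<close> is minimal only among the well-orders on the type of points, but an \<open>r\<close>
  shorter than \<^term>\<open>tp_Sc\<close> has a copy on that type.
\<close>
lemma (in Metric_space) tp_Sc_ordLeq_limit:
  fixes r :: "'i rel"
  assumes limit: "limit_ordinal r" and win: "TWO_wins_G1_kfd mtopology r"
  shows "tp_Sc mtopology \<le>o r"
proof (rule ccontr)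
  have r: "Well_order r" using limit by (simp add: limit_ordinal_def)
  assume contra: "\<not> tp_Sc mtopology \<le>o r"
  then have "r <o tp_Sc mtopology"
    using not_ordLeq_iff_ordLess[OF r tp_Sc(1)[of mtopology]] by blast
  then obtain s :: "'a rel" where s: "r =o s"
    using ordLess_iff_ordIso_Restr[OF tp_Sc(1)[of mtopology] r] by blast
  have "limit_ordinal s" using limit_ordinal_ordIso[OF s limit] .
  moreover have "TWO_wins_G1_kfd mtopology s"
    using TWO_wins_G1_kfd_mono[OF ordIso_imp_ordLeq[OF s] win] .
  ultimately have "TWO_wins_Gc mtopology s"
    using TWO_wins_Gc_if_G1_kfd[of s] by (auto simp: limit_ordinal_def)
  then have "tp_Sc mtopology \<le>o s"
    using tp_Sc(3) \<open>limit_ordinal s\<close> by (auto simp: limit_ordinal_def)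
  then show False using contra s ordIso_symmetric ordLeq_ordIso_trans by blast
qed

text \<open>The shift in the definition of the dimension does no harm: \<delta> \<le> 1 + \<delta>
  for every ordinal \<delta>.\<close>

lemma game_dim_leI:
  assumes "tp_Sc X \<le>o r"
  shows "game_dim_le X r"
proof (cases "topspace X = {}")
  case True
  then show ?thesis by (simp add: game_dim_le_def game_dim_def)
next
  case False
  then obtain \<delta> where \<delta>: "game_dim X = Some \<delta>" "Well_order \<delta>" "natLeq_on 1 +\<^sub>o \<delta> =o tp_Sc X"
    by (rule game_dim)
  have "\<delta> \<le>o natLeq_on 1 +\<^sub>o \<delta>"
    by (rule ordLeq_ord_sum_right[OF natLeq_on_Well_order \<delta>(2)])
  then have "\<delta> \<le>o r" using \<delta>(3) assms ordLeq_ordIso_trans ordLeq_transitive by blast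
  then show ?thesis by (simp add: game_dim_le_def \<delta>(1))
qed

theorem corollary28:
  fixes M :: "'a set" and d :: "'a \<Rightarrow> 'a \<Rightarrow> real" and X :: "'a topology" and \<alpha> :: "'a rel"
  assumes "Metric_space M d"
    and "X = Metric_space.mtopology M d"
    and "separable_space X"
    and "\<not> finite_dimensional X"
    and "\<alpha> = tp_S1_kfd X"
  shows "(limit_ordinal \<alpha> \<longrightarrow> game_dim_le X \<alpha>) \<and>
    (\<not> limit_ordinal \<alpha> \<longrightarrow> game_dim_le X (\<alpha> +\<^sub>o natLeq))"
proof -
  have \<alpha>: "Well_order \<alpha>" "TWO_wins_G1_kfd X \<alpha>" using tp_S1_kfd assms(5) by auto
  note le = game_dim_leI[OF Metric_space.tp_Sc_ordLeq_limit[OF assms(1), folded assms(2)]]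
  \<comment> \<open>Extra innings cannot hurt TWO, so the bound for limit lengths applies to
    \<alpha> + \<omega>, whatever \<alpha> is.\<close>
  have "TWO_wins_G1_kfd X (\<alpha> +\<^sub>o natLeq)"
    using ordLeq_ord_sum_left[OF \<alpha>(1) natLeq_Well_order] \<alpha>(2) by (rule TWO_wins_G1_kfd_mono)
  then have "game_dim_le X (\<alpha> +\<^sub>o natLeq)" by (rule le[OF limit_ordinal_ord_sum_natLeq[OF \<alpha>(1)]])
  moreover have "game_dim_le X \<alpha>" if "limit_ordinal \<alpha>" using le[OF that \<alpha>(2)] .
  ultimately show ?thesis by blast
qed

end
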